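(* Let $f:\mathbb{R}^n\to\mathbb{R}$ be twice differentiable and $\mu$-strongly convex for some $\mu>0$, let $g:\mathbb{R}^n\to(-\infty,\infty]$ be closed convex, let $\nu>0$, and let $x^*$ be the minimizer of $f+g$. Suppose that $\partial_B\mathrm{prox}_{\nu g}$ is a linear Newton approximation (LNA) of $\mathrm{prox}_{\nu g}$ at $x^*-\nu\nabla f(x^* )$, that $\nabla^2f$ is Lipschitz continuous, and that the sequence $\{x^{(k)}\}$ generated by the hybrid linear quasi-Newton method satisfies $x^{(k)}\neq x^*$ for all $k$ and $\lim_{k\to\infty}x^{(k)}=x^*$. Then $\{x^{(k)}\}$ converges superlinearly to $x^*$ if and only if $$\lim_{k\to\infty}\frac{\|(B^{(k)}-\nabla^2f(x^* ))(x^{(k+1)}-x^{(k)})\|_2}{\|x^{(k+1)}-x^{(k)}\|_2}=0.$$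
   Context: $\|\cdot\|_2$ is the Euclidean norm and $\|\cdot\|$ the operator norm on $\mathbb{R}^{n\times n}$. $f$ is $\mu$-strongly convex if $f((1-\lambda)x+\lambda y)\le(1-\lambda)f(x)+\lambda f(y)-\frac{\mu}{2}\lambda(1-\lambda)\|x-y\|_2^2$ for all $x,y$ and $0\le\lambda\le1$. $g$ closed means all sublevel sets are closed; $g$ is not identically $+\infty$. $\nabla^2 f$ Lipschitz continuous means there is $L>0$ with $\|\nabla^2f(x)-\nabla^2f(y)\|\le L\|x-y\|_2$ for all $x,y$. Proximal map: $\mathrm{prox}_{h}(x)=\mathrm{argmin}_{y}\{h(y)+\frac12\|y-x\|_2^2\}$. It is Lipschitz continuous with constant $1$ for closed convex $h$. B-subdifferential of a Lipschitz continuous $F:\mathbb{R}^n\to\mathbb{R}^n$ at $x$: $\partial_BF(x)$ is the set of $V\in\mathbb{R}^{n\times n}$ for which there is a sequence $z^{(k)}\to x$ of points at which $F$ is differentiable with $\nabla F(z^{(k)})\to V$ ($\nabla F$ denotes the Jacobian). LNA: for a continuous $F:\mathbb{R}^n\to\mathbb{R}^n$, a set-valued function $\mathcal{A}$ assigning to each $y\in\mathbb{R}^n$ a subset $\mathcal{A}(y)\subset\mathbb{R}^{n\times n}$ is an LNA of $F$ at $x$ if (i) every $\mathcal{A}(y)$ is compact; (ii) $\mathcal{A}$ is upper-semicontinuous at $x$: for every $\epsilon>0$ there is $\delta>0$ such that $\|x-y\|_2<\delta$ implies $\mathcal{A}(y)\subset\mathcal{A}(x)+\{A:\|A\|<\epsilon\}$;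 (iii) $\|F(x)-F(y)-A(x-y)\|_2=o(\|x-y\|_2)$ as $y\to x$, uniformly over $A\in\mathcal{A}(y)$. Define $F_\nu(x)=x-\mathrm{prox}_{\nu g}(x-\nu\nabla f(x))$; $F_\nu(x)=0$ if and only if $x=x^*$. Hybrid linear quasi-Newton method: given $x^{(1)}\in\mathbb{R}^n$ and a symmetric positive definite $B^{(1)}\in\mathbb{R}^{n\times n}$, for $k=1,2,\dots$: (1) choose any $V^{(k)}\in\partial_B\mathrm{prox}_{\nu g}(x^{(k)}-\nu\nabla f(x^{(k)}))$ and set $d^{(k)}=-\left(I-V^{(k)}(I-\nu B^{(k)})\right)^{-1}F_\nu(x^{(k)})$; (2) set $x^{(k+1)}=x^{(k)}+d^{(k)}$; (3) with $s^{(k)}=x^{(k+1)}-x^{(k)}$ and $y^{(k)}=\nabla f(x^{(k+1)})-\nabla f(x^{(k)})$, set $$B^{(k+1)}=B^{(k)}-\frac{B^{(k)}s^{(k)}(s^{(k)})^TB^{(k)}}{(s^{(k)})^TB^{(k)}s^{(k)}}+\frac{y^{(k)}(y^{(k)})^T}{(y^{(k)})^Ts^{(k)}}.$$ Superlinear convergence to $x^*$: $\lim_{k\to\infty}\|x^{(k+1)}-x^*\|_2/\|x^{(k)}-x^*\|_2=0$. *)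

theory Defs
  imports "HOL-Analysis.Analysis"
begin

subsection \<open>Smooth part\<close>

definition grad :: "(real^'n \<Rightarrow> real) \<Rightarrow> real^'n \<Rightarrow> real^'n" where
  "grad f x = (THE D. GDERIV f x :> D)"

definition hessian :: "(real^'n \<Rightarrow> real) \<Rightarrow> real^'n \<Rightarrow> real^'n^'n" where
  "hessian f x = jacobian (grad f) (at x)"

definition twice_differentiable :: "(real^'n \<Rightarrow> real) \<Rightarrow> bool" where
  "twice_differentiable f \<longleftrightarrow>
     (\<forall>x. f differentiable (at x)) \<and> (\<forall>x. grad f differentiable (at x))"

definition strongly_convex :: "real \<Rightarrow> (real^'n \<Rightarrow> real) \<Rightarrow> bool" where
  "strongly_convex \<mu> f \<longleftrightarrow>
     (\<forall>x y t. 0 \<le> t \<and> t \<le> 1 \<longrightarrow>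
        f ((1 - t) *\<^sub>R x + t *\<^sub>R y)
          \<le> (1 - t) * f x + t * f y - \<mu> / 2 * t * (1 - t) * (norm (x - y))\<^sup>2)"

text \<open>The library norm on \<open>real^'n^'n\<close> is the Frobenius norm, hence the explicit operator norm.\<close>

definition op_norm :: "real^'n^'n \<Rightarrow> real" where
  "op_norm A = onorm (\<lambda>v. A *v v)"

definition lipschitz_hessian :: "(real^'n \<Rightarrow> real) \<Rightarrow> bool" where
  "lipschitz_hessian f \<longleftrightarrow>
     (\<exists>L>0. \<forall>x y. op_norm (hessian f x - hessian f y) \<le> L * norm (x - y))"

lemma grad_eqI:
  assumes "GDERIV f x :> D"
  shows "grad f x = D"
  unfolding grad_def
proof (rule the_equality)
  show "GDERIV f x :> D" by (rule assms)
next
  fix D' assume "GDERIV f x :> D'"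
  with assms have "(\<lambda>h. h \<bullet> D') = (\<lambda>h. h \<bullet> D)"
    unfolding gderiv_def by (metis has_derivative_unique)
  then have "h \<bullet> D' = h \<bullet> D" for h by metis
  then show "D' = D" by (metis vector_eq_ldot)
qed

subsection \<open>Nonsmooth part\<close>

text \<open>
  Extended-valued functions never take the value \<open>-\<infinity>\<close>, so the sum in the convexity
  inequality is well defined; note \<open>0 * \<infinity> = 0\<close> in \<^typ>\<open>ereal\<close> at the endpoints.
\<close>

definition proper :: "(real^'n \<Rightarrow> ereal) \<Rightarrow> bool" where
  "proper g \<longleftrightarrow> (\<forall>x. g x \<noteq> -\<infinity>) \<and> (\<exists>x. g x \<noteq> \<infinity>)"

definition closed_fun :: "(real^'n \<Rightarrow> ereal) \<Rightarrow> bool" where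
  "closed_fun g \<longleftrightarrow> (\<forall>c::real. closed {x. g x \<le> ereal c})"

definition convex_fun :: "(real^'n \<Rightarrow> ereal) \<Rightarrow> bool" where
  "convex_fun g \<longleftrightarrow>
     (\<forall>x y t. 0 \<le> t \<and> t \<le> 1 \<longrightarrow>
        g ((1 - t) *\<^sub>R x + t *\<^sub>R y) \<le> ereal (1 - t) * g x + ereal t * g y)"

definition prox :: "(real^'n \<Rightarrow> ereal) \<Rightarrow> real^'n \<Rightarrow> real^'n" where
  "prox h x = (ARG_MIN (\<lambda>y. h y + ereal ((norm (y - x))\<^sup>2 / 2)) y. True)"

abbreviation prox_scaled :: "real \<Rightarrow> (real^'n \<Rightarrow> ereal) \<Rightarrow> real^'n \<Rightarrow> real^'n" where
  "prox_scaled \<nu> g \<equiv> prox (\<lambda>y. ereal \<nu> * g y)"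

subsection \<open>Generalized derivatives\<close>

definition B_subdifferential :: "(real^'n \<Rightarrow> real^'n) \<Rightarrow> real^'n \<Rightarrow> (real^'n^'n) set" where
  "B_subdifferential F x =
     {V. \<exists>z. z \<longlonglongrightarrow> x \<and> (\<forall>k. F differentiable (at (z k))) \<and>
             (\<lambda>k. jacobian F (at (z k))) \<longlonglongrightarrow> V}"

definition is_LNA ::
  "(real^'n \<Rightarrow> (real^'n^'n) set) \<Rightarrow> (real^'n \<Rightarrow> real^'n) \<Rightarrow> real^'n \<Rightarrow> bool" where
  "is_LNA \<A> F x \<longleftrightarrow>
     continuous_on UNIV F \<and>
     (\<forall>y. compact (\<A> y)) \<and>
     (\<forall>\<epsilon>>0. \<exists>\<delta>>0. \<forall>y. norm (x - y) < \<delta> \<longrightarrow>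
        \<A> y \<subseteq> {A + E | A E. A \<in> \<A> x \<and> op_norm E < \<epsilon>}) \<and>
     (\<forall>\<epsilon>>0. \<exists>\<delta>>0. \<forall>y. norm (x - y) < \<delta> \<longrightarrow>
        (\<forall>A \<in> \<A> y. norm (F x - F y - A *v (x - y)) \<le> \<epsilon> * norm (x - y)))"

subsection \<open>The hybrid linear quasi-Newton method\<close>

definition prox_residual ::
  "(real^'n \<Rightarrow> real) \<Rightarrow> (real^'n \<Rightarrow> ereal) \<Rightarrow> real \<Rightarrow> real^'n \<Rightarrow> real^'n" where
  "prox_residual f g \<nu> x = x - prox_scaled \<nu> g (x - \<nu> *\<^sub>R grad f x)"

definition sym_pos_def :: "real^'n^'n \<Rightarrow> bool" where
  "sym_pos_def B \<longleftrightarrow> transpose B = B \<and> (\<forall>v. v \<noteq> 0 \<longrightarrow> v \<bullet> (B *v v) > 0)"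

definition outer_product :: "real^'n \<Rightarrow> real^'n \<Rightarrow> real^'n^'n" where
  "outer_product u v = (\<chi> i j. u $ i * v $ j)"

definition bfgs_update :: "real^'n^'n \<Rightarrow> real^'n \<Rightarrow> real^'n \<Rightarrow> real^'n^'n" where
  "bfgs_update B s y =
     B - (1 / (s \<bullet> (B *v s))) *\<^sub>R (B ** outer_product s s ** B)
       + (1 / (y \<bullet> s)) *\<^sub>R outer_product y y"

text \<open>
  Iterates are indexed from 1; the entries of \<open>x\<close> and \<open>B\<close> at index 0 are irrelevant.
  The choice of \<open>V\<close> is free at each iteration.
\<close>

definition hybrid_linear_quasi_newton ::
  "(real^'n \<Rightarrow> real) \<Rightarrow> (real^'n \<Rightarrow> ereal) \<Rightarrow> real \<Rightarrow>
   (nat \<Rightarrow> real^'n) \<Rightarrow> (nat \<Rightarrow> real^'n^'n) \<Rightarrow> bool" where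
  "hybrid_linear_quasi_newton f g \<nu> x B \<longleftrightarrow>
     sym_pos_def (B 1) \<and>
     (\<forall>k\<ge>1.
        (\<exists>V \<in> B_subdifferential (prox_scaled \<nu> g) (x k - \<nu> *\<^sub>R grad f (x k)).
           let d = - (matrix_inv (mat 1 - V ** (mat 1 - \<nu> *\<^sub>R B k)) *v prox_residual f g \<nu> (x k))
           in x (k + 1) = x k + d) \<and>
        (let s = x (k + 1) - x k; y = grad f (x (k + 1)) - grad f (x k)
         in B (k + 1) = bfgs_update (B k) s y))"

definition superlinear_convergence :: "(nat \<Rightarrow> real^'n) \<Rightarrow> real^'n \<Rightarrow> bool" where
  "superlinear_convergence x l \<longleftrightarrow>
     (\<lambda>k. norm (x (k + 1) - l) / norm (x k - l)) \<longlonglongrightarrow> 0"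

end

theory Submission
  imports Defs
begin

text \<open>
  Write \<open>P\<close> for the proximal map, \<open>H\<close> for the Hessian of \<open>f\<close> at the minimizer, \<open>e\<^sub>k\<close> for the error of
  the \<open>k\<close>-th iterate and \<open>s\<^sub>k = e\<^sub>k\<^sub>+\<^sub>1 - e\<^sub>k\<close> for the step. The two directions have different reasons.

  If the Dennis-More condition holds, the step is a Newton step up to terms of smaller order.
  Optimality of the minimizer says that it is a zero of the residual, so the Newton approximation
  property of \<open>P\<close> and differentiability of the gradient linearize the residual at the iterates as
  \<open>A\<^sub>k e\<^sub>k\<close> with \<open>A\<^sub>k = I - V\<^sub>k (I - \<nu> H)\<close>, and the step equation becomes
  \<open>A\<^sub>k e\<^sub>k\<^sub>+\<^sub>1 = - \<nu> V\<^sub>k (B\<^sub>k - H) s\<^sub>k + o(|e\<^sub>k|)\<close>. The proximal map is firmly nonexpansive, so every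
  \<open>V\<close> in its B-subdifferential satisfies \<open>|V p|\<^sup>2 \<le> p \<bullet> V p\<close>. This inequality, with strong
  convexity of \<open>f\<close>, makes all \<open>A\<^sub>k\<close> uniformly invertible (\<open>newton_matrix_uniform_lower_bound\<close>), and
  it makes the systems of the method solvable as long as \<open>B\<^sub>k\<close> is positive definite
  (\<open>newton_matrix_invertible\<close>). The conclusion is drawn in \<open>dennis_more_imp_superlinear\<close>.

  Conversely, superlinear convergence bounds \<open>V\<^sub>k (B\<^sub>k - H) s\<^sub>k\<close>, but \<open>V\<^sub>k\<close> may be singular and the
  Dennis-More condition cannot be read off. It is a property of the BFGS matrices themselves.
  Superlinearly convergent errors have a finite sum, and by Lipschitz continuity of the Hessian the
  secant pairs then agree with \<open>H\<close> up to relative errors with finite sum. In variables in which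
  \<open>H = I\<close>, the function \<open>trace B - ln (det B)\<close> of Byrd and Nocedal is bounded below and rises in
  total by a finite amount, whereas each step with \<open>B\<^sub>k s\<^sub>k\<close> far from \<open>s\<^sub>k\<close> lowers it by a definite
  amount. Hence \<open>|B\<^sub>k s\<^sub>k - s\<^sub>k| / |s\<^sub>k|\<close> tends to zero (\<open>bfgs_dennis_more_identity\<close>,
  \<open>bfgs_dennis_more\<close>). Determinant and positive definiteness of the updates come from writing the
  update as a congruence (\<open>bfgs_update_product_form\<close>), and the change of variables from a Cholesky
  factorization of \<open>H\<close>.
\<close>

section \<open>Matrices and quadratic forms\<close>

lemma outer_product_mult_vec: "outer_product u v *v w = (v \<bullet> w) *\<^sub>R u"
  by (simp add: vec_eq_iff outer_product_def matrix_vector_mult_def inner_vec_def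
      sum_distrib_left mult_ac)

lemma inner_matrix_transpose:
  fixes A :: "real^'n^'m"
  shows "u \<bullet> (A *v w) = (transpose A *v u) \<bullet> w"
  by (metis dot_lmul_matrix transpose_matrix_vector)

lemma inner_symmetric_matrix:
  fixes A :: "real^'n^'n"
  assumes "transpose A = A"
  shows "u \<bullet> (A *v w) = w \<bullet> (A *v u)"
  by (metis assms inner_commute inner_matrix_transpose)

lemma transpose_eq_if_inner_symmetric:
  fixes A :: "real^'n^'n"
  assumes "\<And>u w. u \<bullet> (A *v w) = w \<bullet> (A *v u)"
  shows "transpose A = A"
proof -
  have "transpose A *v u = A *v u" for u
  proof -
    have "(transpose A *v u) \<bullet> w = (A *v u) \<bullet> w" for w
      by (metis assms inner_commute inner_matrix_transpose)
    then show ?thesis by (metis vector_eq_rdot)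
  qed
  then show ?thesis by (simp add: matrix_eq)
qed

lemma matrix_vector_norm_bound:
  fixes A :: "real^'n^'m"
  obtains K where "0 < K" "\<And>v. norm (A *v v) \<le> K * norm v"
  using linear_bounded_pos[OF matrix_vector_mul_linear[of A]] by auto

text \<open>
  The quadratic \<open>t \<mapsto> (u + t v) \<bullet> A (u + t v)\<close> is nonnegative, so its discriminant
  is not positive.
\<close>
lemma psd_cauchy_schwarz:
  fixes A :: "real^'n^'n"
  assumes sym: "transpose A = A" and psd: "\<And>v. 0 \<le> v \<bullet> (A *v v)"
  shows "(u \<bullet> (A *v v))\<^sup>2 \<le> (u \<bullet> (A *v u)) * (v \<bullet> (A *v v))"
proof -
  define a b c where "a = v \<bullet> (A *v v)" and "b = u \<bullet> (A *v v)" and "c = u \<bullet> (A *v u)"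
  have quad: "0 \<le> c + 2 * t * b + t\<^sup>2 * a" for t
  proof -
    have "(u + t *\<^sub>R v) \<bullet> (A *v (u + t *\<^sub>R v)) = c + 2 * t * b + t\<^sup>2 * a"
      using inner_symmetric_matrix[OF sym, of v u]
      by (simp add: a_def b_def c_def algebra_simps matrix_vector_right_distrib
          matrix_vector_mult_scaleR power2_eq_square)
    then show ?thesis using psd[of "u + t *\<^sub>R v"] by simp
  qed
  have a0: "0 \<le> a" unfolding a_def by (rule psd)
  show ?thesis
  proof (cases "a = 0")
    case True
    have "b = 0"
    proof (rule ccontr)
      assume "b \<noteq> 0"
      then show False
        using quad[of "- (c + 1) / (2 * b)"] True by (simp add: field_simps)
    qed
    with True show ?thesis by (simp add: a_def b_def)
  next
    case False
    then have "0 \<le> c - b\<^sup>2 / a" using quad[of "- b / a"]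
      by (simp add: field_simps power2_eq_square)
    with False a0 have "b\<^sup>2 \<le> c * a" by (simp add: field_simps)
    then show ?thesis by (simp add: a_def b_def c_def)
  qed
qed

text \<open>
  This is Cholesky elimination. Subtracting the rank-one matrix
  \<open>(A e\<^sub>k) (A e\<^sub>k)\<^sup>T / A\<^sub>k\<^sub>k\<close> annihilates row and column \<open>k\<close>, and the
  Cauchy-Schwarz inequality says that the remainder is still positive semidefinite. Letting the
  set \<open>S\<close> of rows that may be nonzero shrink makes this an induction on a finite set, although
  the dimension is a type.
\<close>
lemma psd_eq_sum_outer_products:
  fixes A :: "real^'n^'n"
  assumes "finite S" "transpose A = A" "\<And>v. 0 \<le> v \<bullet> (A *v v)"
    "\<And>i j. i \<notin> S \<Longrightarrow> A $ i $ j = 0"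
  shows "\<exists>g. A = (\<Sum>i\<in>S. outer_product (g i) (g i))"
  using assms
proof (induction S arbitrary: A rule: finite_induct)
  case empty
  then have "A = 0" by (simp add: vec_eq_iff)
  then show ?case by simp
next
  case (insert k S)
  note sym = insert.prems(1) and psd = insert.prems(2) and zero = insert.prems(3)
  define e :: "real^'n" where "e = axis k 1"
  define p where "p = A *v e"
  define q where "q = e \<bullet> p"
  have cs: "(e \<bullet> (A *v v))\<^sup>2 \<le> q * (v \<bullet> (A *v v))" for v
    unfolding q_def p_def by (rule psd_cauchy_schwarz[OF sym psd])
  have q0: "0 \<le> q" unfolding q_def p_def by (rule psd)
  have pe: "p \<bullet> v = e \<bullet> (A *v v)" for v
    by (metis inner_commute inner_symmetric_matrix p_def sym)
  define A' where "A' = A - (1 / q) *\<^sub>R outer_product p p"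
  have A'v: "A' *v v = A *v v - ((p \<bullet> v) / q) *\<^sub>R p" for v
    by (simp add: A'_def matrix_vector_mult_diff_rdistrib scaleR_matrix_vector_assoc[symmetric]
        outer_product_mult_vec)
  have sym': "transpose A' = A'"
  proof (rule transpose_eq_if_inner_symmetric)
    fix u w :: "real^'n"
    show "u \<bullet> (A' *v w) = w \<bullet> (A' *v u)"
      using inner_symmetric_matrix[OF sym, of u w]
      by (simp add: A'v inner_diff_right inner_commute)
  qed
  \<comment> \<open>If \<open>q = 0\<close>, division by zero leaves \<open>A\<close> unchanged, and Cauchy-Schwarz shows that
    row \<open>k\<close> of \<open>A\<close> is then already zero.\<close>
  have psd': "0 \<le> v \<bullet> (A' *v v)" for v
  proof -
    have "v \<bullet> (A' *v v) = v \<bullet> (A *v v) - (p \<bullet> v)\<^sup>2 / q"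
      by (simp add: A'v inner_diff_right power2_eq_square inner_commute)
    moreover have "(p \<bullet> v)\<^sup>2 / q \<le> v \<bullet> (A *v v)"
      using cs[of v] q0 psd[of v] by (cases "q = 0") (auto simp: pe field_simps)
    ultimately show ?thesis by simp
  qed
  have pcomp: "p $ i = A $ i $ k" for i
    by (simp add: p_def e_def matrix_vector_mult_basis column_def)
  have qk: "q = A $ k $ k" by (simp add: q_def e_def pcomp inner_axis')
  have zero': "A' $ i $ j = 0" if "i \<notin> S" for i j
  proof (cases "i = k")
    case True
    have pj: "p $ j = A $ k $ j" using sym by (metis pcomp transpose_def vec_lambda_beta)
    have "q = 0 \<Longrightarrow> A $ k $ j = 0"
      using cs[of "axis j 1"]
      by (simp add: e_def inner_axis' matrix_vector_mult_basis column_def)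
    then show ?thesis using True
      using qk pj pcomp[of k]
      by (cases "q = 0") (simp_all add: A'_def outer_product_def)
  next
    case False
    then show ?thesis using zero that by (simp add: A'_def outer_product_def pcomp)
  qed
  obtain g where g: "A' = (\<Sum>i\<in>S. outer_product (g i) (g i))"
    using insert.IH[OF sym' psd' zero'] by blast
  define g' where "g' = g(k := (1 / sqrt q) *\<^sub>R p)"
  have "outer_product (g' k) (g' k) = (1 / q) *\<^sub>R outer_product p p"
    using q0 by (simp add: g'_def outer_product_def vec_eq_iff field_simps)
  moreover have "(\<Sum>i\<in>S. outer_product (g' i) (g' i)) = A'"
    unfolding g by (rule sum.cong) (use insert.hyps in \<open>auto simp: g'_def\<close>)
  ultimately have "A = (\<Sum>i\<in>insert k S. outer_product (g' i) (g' i))"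
    using insert.hyps by (simp add: A'_def)
  then show ?case by blast
qed

lemma sym_pos_defD:
  assumes "sym_pos_def B"
  shows "transpose B = B" and "v \<noteq> 0 \<Longrightarrow> 0 < v \<bullet> (B *v v)" and "0 \<le> v \<bullet> (B *v v)"
  using assms by (auto simp: sym_pos_def_def intro: less_imp_le) (cases "v = 0"; force simp: less_imp_le)

lemma sym_pos_def_cholesky:
  fixes A :: "real^'n^'n"
  assumes "sym_pos_def A"
  obtains G :: "real^'n^'n" where "A = transpose G ** G" "invertible G"
proof -
  have "\<exists>g. A = (\<Sum>i\<in>(UNIV :: 'n set). outer_product (g i) (g i))"
    by (rule psd_eq_sum_outer_products) (use sym_pos_defD[OF assms] in auto)
  then obtain g where g: "A = (\<Sum>i\<in>(UNIV :: 'n set). outer_product (g i) (g i))" by blast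
  define G where "G = (\<chi> i. g i)"
  have AG: "A = transpose G ** G"
    unfolding g G_def
    by (simp add: vec_eq_iff matrix_matrix_mult_def transpose_def outer_product_def)
  have "v = 0" if "G *v v = 0" for v
  proof -
    have "A *v v = 0" by (simp add: AG that flip: matrix_vector_mul_assoc)
    then show ?thesis using sym_pos_defD(2)[OF assms, of v] by auto
  qed
  then have "invertible G"
    by (metis invertible_left_inverse matrix_left_invertible_ker)
  with AG show ?thesis by (rule that)
qed

lemma sym_pos_def_congruence:
  fixes A E :: "real^'n^'n"
  assumes "sym_pos_def A" "invertible E"
  shows "sym_pos_def (transpose E ** A ** E)"
proof -
  have sym: "transpose (transpose E ** A ** E) = transpose E ** A ** E"
    using sym_pos_defD(1)[OF assms(1)]
    by (simp add: matrix_transpose_mul matrix_mul_assoc)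
  have "0 < v \<bullet> ((transpose E ** A ** E) *v v)" if "v \<noteq> 0" for v
  proof -
    have "v \<bullet> ((transpose E ** A ** E) *v v) = (E *v v) \<bullet> (A *v (E *v v))"
      by (metis inner_matrix_transpose inner_commute matrix_vector_mul_assoc)
    moreover have "E *v v \<noteq> 0"
      using that assms(2) by (metis invertible_left_inverse matrix_left_invertible_ker)
    ultimately show ?thesis using sym_pos_defD(2)[OF assms(1)] by auto
  qed
  with sym show ?thesis by (auto simp: sym_pos_def_def)
qed

lemma sym_pos_def_det_pos:
  fixes A :: "real^'n^'n"
  assumes "sym_pos_def A"
  shows "0 < det A"
proof -
  obtain G :: "real^'n^'n" where "A = transpose G ** G" "invertible G"
    using sym_pos_def_cholesky[OF assms] .
  then have "det A = det G * det G" "det G \<noteq> 0"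
    by (auto simp: det_mul det_transpose invertible_det_nz)
  then show ?thesis by (metis not_real_square_gt_zero)
qed

text \<open>
  An orthogonal change of coordinates turns \<open>v\<close> into a multiple of a basis vector. The matrix
  then differs from the identity in a single column, and Cramer's rule gives its determinant.
\<close>
lemma det_rank_one_update:
  fixes u v :: "real^'n"
  shows "det (mat 1 + outer_product u v) = 1 + u \<bullet> v"
proof (cases "v = 0")
  case True
  then have "outer_product u v = 0" by (simp add: outer_product_def vec_eq_iff)
  with True show ?thesis by simp
next
  case False
  define k :: 'n where "k = undefined"
  define w where "w = v /\<^sub>R norm v"
  have "norm w = 1" using False by (simp add: w_def)
  then obtain Q :: "real^'n^'n" where Q: "orthogonal_matrix Q" "Q *v axis k 1 = w"
    using orthogonal_matrix_exists_basis[of w k] by blast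
  define p where "p = axis k 1 + norm v *\<^sub>R (transpose Q *v u)"
  define C :: "real^'n^'n" where "C = (\<chi> i j. if j = k then p $ i else mat 1 $ i $ j)"
  have QQ: "transpose Q ** Q = mat 1" "Q ** transpose Q = mat 1"
    using Q(1) by (auto simp: orthogonal_matrix_def)
  have Cv: "C *v z = z + (z $ k * norm v) *\<^sub>R (transpose Q *v u)" for z
  proof -
    have "(C *v z) $ i = (z + (z $ k * norm v) *\<^sub>R (transpose Q *v u)) $ i" for i
    proof -
      have "(C *v z) $ i = (\<Sum>j\<in>UNIV. (if j = i then z $ j else 0)
          + (if j = k then (p $ i - (if i = k then 1 else 0)) * z $ j else 0))"
        unfolding matrix_vector_mult_def C_def
        by (auto simp: mat_def algebra_simps intro!: sum.cong)
      also have "\<dots> = z $ i + (p $ i - (if i = k then 1 else 0)) * z $ k"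
        by (simp add: sum.distrib)
      finally show ?thesis by (simp add: p_def axis_def algebra_simps)
    qed
    then show ?thesis by (simp add: vec_eq_iff)
  qed
  have "transpose Q ** (mat 1 + outer_product u v) ** Q = C"
  proof (subst matrix_eq, rule allI)
    fix z
    have "v \<bullet> (Q *v z) = z $ k * norm v"
    proof -
      have "v = norm v *\<^sub>R (Q *v axis k 1)" using Q(2) False by (simp add: w_def)
      then have "v \<bullet> (Q *v z) = norm v * ((Q *v axis k 1) \<bullet> (Q *v z))"
        by (metis inner_scaleR_left)
      also have "(Q *v axis k 1) \<bullet> (Q *v z) = axis k 1 \<bullet> z"
        by (simp add: inner_matrix_transpose matrix_vector_mul_assoc QQ del: transpose_matrix_vector)
      finally show ?thesis by (simp add: inner_axis')
    qed
    then show "(transpose Q ** (mat 1 + outer_product u v) ** Q) *v z = C *v z"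
      by (simp add: Cv matrix_vector_mult_add_rdistrib outer_product_mult_vec matrix_vector_right_distrib
          matrix_vector_mult_scaleR matrix_vector_mul_assoc[of "transpose Q" Q] QQ
          del: transpose_matrix_vector flip: matrix_vector_mul_assoc)
  qed
  moreover have "det (transpose Q ** (mat 1 + outer_product u v) ** Q) = det (mat 1 + outer_product u v)"
    using arg_cong[OF QQ(1), of det] by (simp add: det_mul)
  moreover have "det C = 1 + u \<bullet> v"
  proof -
    have "det C = p $ k * det (mat 1 :: real^'n^'n)"
      using cramer_lemma[of k "mat 1 :: real^'n^'n" p]
      unfolding C_def matrix_vector_mul_lid .
    also have "p $ k = 1 + norm v * ((transpose Q *v u) \<bullet> axis k 1)"
      by (simp add: p_def inner_axis)
    also have "(transpose Q *v u) \<bullet> axis k 1 = u \<bullet> w"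
      by (metis Q(2) inner_matrix_transpose)
    also have "norm v * (u \<bullet> w) = u \<bullet> v"
      using False by (simp add: w_def)
    finally show ?thesis by simp
  qed
  ultimately show ?thesis by simp
qed

section \<open>The BFGS update and its potential function\<close>

lemma bfgs_update_eq:
  assumes "transpose B = B"
  shows "bfgs_update B s y = B - (1 / (s \<bullet> (B *v s))) *\<^sub>R outer_product (B *v s) (B *v s)
    + (1 / (y \<bullet> s)) *\<^sub>R outer_product y y"
proof -
  have "B ** outer_product s s ** B = outer_product (B *v s) (B *v s)"
    by (subst matrix_eq)
      (metis assms inner_matrix_transpose matrix_vector_mul_assoc matrix_vector_mult_scaleR
        outer_product_mult_vec)
  then show ?thesis by (simp add: bfgs_update_def)
qed

lemma bfgs_update_mult_vec:
  assumes "transpose B = B"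
  shows "bfgs_update B s y *v v = B *v v - (((B *v s) \<bullet> v) / (s \<bullet> (B *v s))) *\<^sub>R (B *v s)
    + ((y \<bullet> v) / (y \<bullet> s)) *\<^sub>R y"
  by (simp add: bfgs_update_eq[OF assms] matrix_vector_mult_add_rdistrib
      matrix_vector_mult_diff_rdistrib scaleR_matrix_vector_assoc[symmetric] outer_product_mult_vec)

text \<open>
  The BFGS update is a congruence \<open>E\<^sup>T B E\<close> by a rank-one perturbation \<open>E = I + s w\<^sup>T\<close> of
  the identity. Both positive definiteness and the determinant of the updated matrix follow from
  this. For any \<open>w\<close>, with \<open>a = s \<bullet> B s\<close>, completing the square gives
  \<open>E\<^sup>T B E = B - (B s) (B s)\<^sup>T / a + a (w + B s / a) (w + B s / a)\<^sup>T\<close>, so \<open>w\<close> is chosen to make the last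
  term \<open>y y\<^sup>T / (y \<bullet> s)\<close>.
\<close>
lemma bfgs_update_product_form:
  fixes B :: "real^'n^'n" and s y :: "real^'n"
  assumes B: "sym_pos_def B" and s: "s \<noteq> 0" and ys: "0 < y \<bullet> s"
  obtains E where "bfgs_update B s y = transpose E ** B ** E"
    "(det E)\<^sup>2 = (y \<bullet> s) / (s \<bullet> (B *v s))"
proof -
  define a b c where "a = s \<bullet> (B *v s)" and "b = y \<bullet> s" and "c = sqrt (a * b)"
  have ab: "0 < a" "0 < b" using sym_pos_defD(2)[OF B s] ys by (auto simp: a_def b_def)
  then have c: "0 < c" "c * c = a * b" by (auto simp: c_def)
  define w where "w = (1 / c) *\<^sub>R y - (1 / a) *\<^sub>R (B *v s)"
  define E where "E = mat 1 + outer_product s w"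
  have Ev: "E *v v = v + (w \<bullet> v) *\<^sub>R s" for v
    by (simp add: E_def matrix_vector_mult_add_rdistrib outer_product_mult_vec)
  have ETv: "transpose E *v v = v + (s \<bullet> v) *\<^sub>R w" for v
  proof -
    have "transpose E = mat 1 + outer_product w s"
      by (simp add: E_def transpose_def outer_product_def mat_def vec_eq_iff mult.commute)
    then show ?thesis by (simp add: matrix_vector_mult_add_rdistrib outer_product_mult_vec)
  qed
  have "bfgs_update B s y *v v = (transpose E ** B ** E) *v v" for v
  proof -
    define p r where "p = (B *v s) \<bullet> v" and "r = y \<bullet> v"
    have wv: "w \<bullet> v = r / c - p / a" by (simp add: w_def inner_diff_left p_def r_def)
    have sBv: "s \<bullet> (B *v v) = p"
      by (metis B inner_commute inner_symmetric_matrix p_def sym_pos_defD(1))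
    have "(transpose E ** B ** E) *v v = B *v v + (w \<bullet> v) *\<^sub>R (B *v s)
        + (p + (w \<bullet> v) * a) *\<^sub>R w"
      by (simp add: ETv Ev matrix_vector_right_distrib matrix_vector_mult_scaleR inner_add_right sBv
          a_def scaleR_add_left scaleR_add_right del: transpose_matrix_vector flip: matrix_vector_mul_assoc)
    also have "p + (w \<bullet> v) * a = a * r / c"
      using ab c(1) by (simp add: wv field_simps)
    also have "B *v v + (w \<bullet> v) *\<^sub>R (B *v s) + (a * r / c) *\<^sub>R w
        = B *v v + (w \<bullet> v - r / c) *\<^sub>R (B *v s) + (a * r / (c * c)) *\<^sub>R y"
      using ab c(1) by (simp add: w_def algebra_simps)
    also have "\<dots> = B *v v - (p / a) *\<^sub>R (B *v s) + (r / b) *\<^sub>R y"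
      using ab by (simp add: wv c(2))
    finally show ?thesis
      by (simp add: bfgs_update_mult_vec[OF sym_pos_defD(1)[OF B]] a_def b_def p_def r_def)
  qed
  then have "bfgs_update B s y = transpose E ** B ** E" by (simp add: matrix_eq)
  moreover have "(det E)\<^sup>2 = b / a"
  proof -
    have "det E = b / c"
      using ab c by (simp add: E_def det_rank_one_update w_def inner_diff_right inner_commute[of s y] flip: a_def b_def)
    then have "(det E)\<^sup>2 = b * b / (c * c)" by (simp add: power2_eq_square)
    then show ?thesis using ab by (simp add: c(2))
  qed
  ultimately show ?thesis using that by (simp add: a_def b_def)
qed

lemma sym_pos_def_bfgs_update:
  assumes "sym_pos_def B" "s \<noteq> 0" "0 < y \<bullet> s"
  shows "sym_pos_def (bfgs_update B s y)"
proof -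
  obtain E where E: "bfgs_update B s y = transpose E ** B ** E"
    "(det E)\<^sup>2 = (y \<bullet> s) / (s \<bullet> (B *v s))"
    using bfgs_update_product_form[OF assms] .
  have "det E \<noteq> 0" using E(2) assms(3) sym_pos_defD(2)[OF assms(1,2)] by auto
  then show ?thesis
    unfolding E(1) by (intro sym_pos_def_congruence assms) (simp add: invertible_det_nz)
qed

lemma det_bfgs_update:
  assumes "sym_pos_def B" "s \<noteq> 0" "0 < y \<bullet> s"
  shows "det (bfgs_update B s y) = det B * ((y \<bullet> s) / (s \<bullet> (B *v s)))"
proof -
  obtain E where E: "bfgs_update B s y = transpose E ** B ** E"
    "(det E)\<^sup>2 = (y \<bullet> s) / (s \<bullet> (B *v s))"
    using bfgs_update_product_form[OF assms] .
  then show ?thesis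
    by (metis det_mul det_transpose mult.commute mult.left_commute power2_eq_square)
qed

lemma trace_bfgs_update:
  assumes "sym_pos_def B"
  shows "trace (bfgs_update B s y)
    = trace B - (norm (B *v s))\<^sup>2 / (s \<bullet> (B *v s)) + (norm y)\<^sup>2 / (y \<bullet> s)"
proof -
  have outer: "trace (c *\<^sub>R outer_product v v) = c * (norm v)\<^sup>2" for c and v :: "real^'a"
    by (simp add: trace_def outer_product_def power2_norm_eq_inner inner_vec_def sum_distrib_left)
  show ?thesis
    by (simp add: bfgs_update_eq[OF sym_pos_defD(1)[OF assms]] trace_add trace_sub outer)
qed

lemma abs_entry_le_trace:
  fixes B :: "real^'n^'n"
  assumes "sym_pos_def B"
  shows "\<bar>B $ i $ j\<bar> \<le> trace B"
proof -
  have entry: "axis i 1 \<bullet> (B *v axis j 1) = B $ i $ j" for i j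
    by (simp add: inner_axis' matrix_vector_mult_basis column_def)
  have diag: "0 \<le> B $ i $ i" for i
    using sym_pos_defD(3)[OF assms, of "axis i 1"] by (simp add: entry)
  have diag_le: "B $ i $ i \<le> trace B" for i
    unfolding trace_def by (rule member_le_sum) (auto simp: diag)
  have "(B $ i $ j)\<^sup>2 \<le> B $ i $ i * B $ j $ j"
    using psd_cauchy_schwarz[OF sym_pos_defD(1,3)[OF assms], of "axis i 1" "axis j 1"]
    by (simp add: entry)
  also have "\<dots> \<le> trace B * trace B"
    by (intro mult_mono diag diag_le order_trans[OF diag diag_le])
  finally have "\<bar>B $ i $ j\<bar>\<^sup>2 \<le> (trace B)\<^sup>2" by (simp add: power2_eq_square)
  then show ?thesis
    by (rule power2_le_imp_le) (rule order_trans[OF diag diag_le])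
qed

text \<open>
  A crude substitute for Hadamard's inequality, by the Leibniz formula. It is enough to see that
  \<open>ln (det B)\<close> grows only logarithmically in the trace.
\<close>
lemma abs_det_le:
  fixes A :: "real^'n^'n"
  assumes "\<And>i j. \<bar>A $ i $ j\<bar> \<le> t"
  shows "\<bar>det A\<bar> \<le> fact CARD('n) * t ^ CARD('n)"
proof -
  have "\<bar>det A\<bar> \<le> (\<Sum>p\<in>{p. p permutes (UNIV :: 'n set)}. t ^ CARD('n))"
    unfolding det_def
  proof (rule order_trans[OF sum_abs], rule sum_mono)
    fix p :: "'n \<Rightarrow> 'n"
    have "(\<Prod>i\<in>UNIV. \<bar>A $ i $ p i\<bar>) \<le> (\<Prod>i\<in>(UNIV :: 'n set). t)"
      by (rule prod_mono) (auto simp: assms)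
    then show "\<bar>of_int (sign p) * (\<Prod>i\<in>UNIV. A $ i $ p i)\<bar> \<le> t ^ CARD('n)"
      by (simp add: abs_mult abs_prod sign_def)
  qed
  then show ?thesis by (simp add: card_permutations)
qed

text \<open>
  In terms of the eigenvalues \<open>\<lambda>\<close> of a symmetric positive definite \<open>B\<close> this is the sum of
  \<open>\<lambda> - ln \<lambda>\<close>. It penalizes eigenvalues near \<open>0\<close> and near \<open>\<infinity>\<close> and is minimal at the identity.
\<close>
definition bfgs_potential :: "real^'n^'n \<Rightarrow> real" where
  "bfgs_potential B = trace B - ln (det B)"

text \<open>
  The determinant is at most a constant times a power of the trace, and a linear function of the
  trace beats its logarithm.
\<close>
lemma bfgs_potential_bounded_below:
  obtains K where "\<And>B :: real^'n^'n. sym_pos_def B \<Longrightarrow> K \<le> bfgs_potential B"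
proof
  fix B :: "real^'n^'n"
  assume B: "sym_pos_def B"
  define n where "n = real CARD('n)"
  have n: "0 < n" by (simp add: n_def)
  note d = sym_pos_def_det_pos[OF B]
  have le: "det B \<le> fact CARD('n) * trace B ^ CARD('n)"
    using abs_det_le[of B "trace B"] abs_entry_le_trace[OF B] by fastforce
  have t: "0 < trace B"
  proof (rule ccontr)
    assume "\<not> 0 < trace B"
    moreover have "0 \<le> trace B" using abs_entry_le_trace[OF B] by (meson abs_ge_zero order_trans)
    ultimately have "trace B = 0" by simp
    with le d show False by (simp add: power_0_left)
  qed
  have "ln (det B) \<le> ln (fact CARD('n) * trace B ^ CARD('n))"
    using d le by (intro ln_mono) auto
  also have "\<dots> = ln (fact CARD('n)) + n * ln (trace B)"
    using t by (simp add: ln_mult ln_realpow n_def)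
  finally have *: "ln (det B) \<le> ln (fact CARD('n)) + n * ln (trace B)" .
  have "ln (trace B) = ln (trace B / n) + ln n" using t n by (simp add: ln_div)
  moreover have "ln (trace B / n) \<le> trace B / n - 1" using t n by (intro ln_le_minus_one) auto
  ultimately have "n * ln (trace B) \<le> n * (trace B / n - 1 + ln n)"
    using n by (intro mult_left_mono) auto
  also have "\<dots> = trace B - n + n * ln n" using n by (simp add: field_simps)
  finally show "n - n * ln n - ln (fact CARD('n)) \<le> bfgs_potential B"
    using * by (simp add: bfgs_potential_def)
qed

text \<open>
  Here \<open>c\<close> is the squared cosine of the angle between \<open>s\<close> and \<open>B s\<close>. The potential increases
  by at most a multiple of the relative error \<open>\<epsilon>\<close> of the secant pair, while the terms
  \<open>r - 1 - ln r\<close> and \<open>- ln c\<close> are nonnegative and vanish only if \<open>r = c = 1\<close>, that is, if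
  \<open>B s = s\<close>. The increase \<open>7 \<epsilon>\<close> is made up of \<open>5 \<epsilon>\<close> from \<open>|y|\<^sup>2 / (y \<bullet> s) - 1\<close> and \<open>2 \<epsilon>\<close> from
  \<open>- ln ((y \<bullet> s) / (s \<bullet> s))\<close>.
\<close>
lemma bfgs_potential_update_le:
  fixes B :: "real^'n^'n"
  assumes B: "sym_pos_def B" and s: "s \<noteq> 0" and eps: "0 \<le> \<epsilon>" "\<epsilon> \<le> 1/4"
    and ys: "norm (y - s) \<le> \<epsilon> * norm s"
  defines "r \<equiv> (norm (B *v s))\<^sup>2 / (s \<bullet> (B *v s))"
    and "c \<equiv> (s \<bullet> (B *v s))\<^sup>2 / ((norm s)\<^sup>2 * (norm (B *v s))\<^sup>2)"
  shows "bfgs_potential (bfgs_update B s y)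
    \<le> bfgs_potential B + 7 * \<epsilon> - ((r - 1 - ln r) - ln c)"
proof -
  define a b n where "a = s \<bullet> (B *v s)" and "b = y \<bullet> s" and "n = (norm s)\<^sup>2"
  have a: "0 < a" using sym_pos_defD(2)[OF B s] by (simp add: a_def)
  have n: "0 < n" using s by (simp add: n_def)
  have Bs: "B *v s \<noteq> 0" using a by (auto simp: a_def)
  have "\<bar>(y - s) \<bullet> s\<bar> \<le> norm (y - s) * norm s" by (rule Cauchy_Schwarz_ineq2)
  also have "\<dots> \<le> \<epsilon> * norm s * norm s" by (intro mult_right_mono ys) simp
  finally have "\<bar>b - n\<bar> \<le> \<epsilon> * n"
    by (simp add: b_def n_def inner_diff_left power2_norm_eq_inner power2_eq_square mult.assoc
        flip: power2_eq_square)
  then have bn: "(1 - \<epsilon>) * n \<le> b" by (simp add: algebra_simps)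
  have b: "0 < b" using bn n eps mult_pos_pos[of "1 - \<epsilon>" n] by linarith
  have ln_m: "- ln (b / n) \<le> 2 * \<epsilon>"
  proof -
    have "- ln (b / n) = ln (n / b)" using b n by (simp add: ln_div)
    also have "\<dots> \<le> n / b - 1" using b n by (intro ln_le_minus_one) auto
    also have "n / b \<le> 1 / (1 - \<epsilon>)" using bn b eps by (simp add: field_simps)
    also have "1 / (1 - \<epsilon>) \<le> 1 + 2 * \<epsilon>"
    proof -
      have "\<epsilon> * \<epsilon> \<le> \<epsilon> * (1/4)" using eps by (intro mult_left_mono) auto
      then have "1 \<le> (1 + 2 * \<epsilon>) * (1 - \<epsilon>)" using eps by (simp add: algebra_simps)
      then show ?thesis using eps by (simp add: field_simps)
    qed
    finally show ?thesis by simp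
  qed
  have M: "(norm y)\<^sup>2 / b \<le> 1 + 5 * \<epsilon>"
  proof -
    have "norm y \<le> norm (y - s) + norm s" using norm_triangle_sub[of y s] by simp
    also have "\<dots> \<le> (1 + \<epsilon>) * norm s" using ys by (simp add: algebra_simps)
    finally have "(norm y)\<^sup>2 \<le> ((1 + \<epsilon>) * norm s)\<^sup>2" by (intro power_mono) auto
    also have "\<dots> = (1 + \<epsilon>)\<^sup>2 * n" by (simp add: n_def power_mult_distrib)
    also have "(1 + \<epsilon>)\<^sup>2 \<le> (1 + 5 * \<epsilon>) * (1 - \<epsilon>)"
    proof -
      have "\<epsilon> * \<epsilon> \<le> \<epsilon> * (1/4)" using eps by (intro mult_left_mono) auto
      then show ?thesis using eps by (simp add: algebra_simps power2_eq_square)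
    qed
    finally have "(norm y)\<^sup>2 \<le> (1 + 5 * \<epsilon>) * ((1 - \<epsilon>) * n)" using n by (simp add: mult.assoc)
    also have "\<dots> \<le> (1 + 5 * \<epsilon>) * b" using bn eps by (intro mult_left_mono) auto
    finally show ?thesis using b by (simp add: field_simps)
  qed
  have "ln (b / a) = ln (b / n) - ln r - ln c"
    using a b n Bs
    by (simp add: r_def c_def ln_div ln_mult ln_realpow flip: a_def n_def)
  moreover have "bfgs_potential (bfgs_update B s y)
    = bfgs_potential B - r + (norm y)\<^sup>2 / b - ln (b / a)"
    using sym_pos_def_det_pos[OF B] a b
    by (simp add: bfgs_potential_def trace_bfgs_update[OF B] det_bfgs_update[OF B s] r_def ln_mult
        ln_div flip: a_def b_def)
  ultimately show ?thesis using ln_m M by simp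
qed

lemma tendsto_zero_if_potential_decreases:
  fixes \<psi> \<epsilon> t :: "nat \<Rightarrow> real"
  assumes step: "\<And>k. \<psi> (Suc k) \<le> \<psi> k + \<epsilon> k - t k"
    and "\<And>k. 0 \<le> t k" "\<And>k. 0 \<le> \<epsilon> k" "summable \<epsilon>" "\<And>k. K \<le> \<psi> k"
  shows "t \<longlonglongrightarrow> 0"
proof -
  have telescope: "(\<Sum>k<n. t k) \<le> \<psi> 0 - \<psi> n + (\<Sum>k<n. \<epsilon> k)" for n
  proof (induction n)
    case (Suc n)
    then show ?case using step[of n] by simp
  qed simp
  have "summable t"
  proof (rule summableI_nonneg_bounded)
    fix n
    have "(\<Sum>k<n. \<epsilon> k) \<le> suminf \<epsilon>" using assms by (intro sum_le_suminf) auto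
    then show "(\<Sum>k<n. t k) \<le> \<psi> 0 - K + suminf \<epsilon>"
      using telescope[of n] assms(5)[of n] by linarith
  qed (rule assms)
  then show ?thesis by (rule summable_LIMSEQ_zero)
qed

text \<open>
  Applying \<open>ln t \<le> t - 1\<close> at \<open>t = sqrt r\<close> gives \<open>(sqrt r - 1)\<^sup>2 \<le> r - 1 - ln r\<close>.
\<close>
lemma tendsto_one_if_minus_ln_tendsto_zero:
  fixes r :: "nat \<Rightarrow> real"
  assumes "\<And>k. 0 < r k" "(\<lambda>k. r k - 1 - ln (r k)) \<longlonglongrightarrow> 0"
  shows "r \<longlonglongrightarrow> 1"
proof -
  have le: "(sqrt (r k) - 1)\<^sup>2 \<le> r k - 1 - ln (r k)" for k
  proof -
    have "ln (r k) = 2 * ln (sqrt (r k))" using assms(1)[of k] by (simp add: ln_sqrt)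
    moreover have "ln (sqrt (r k)) \<le> sqrt (r k) - 1"
      using assms(1)[of k] by (intro ln_le_minus_one) auto
    ultimately show ?thesis using assms(1)[of k] by (simp add: power2_diff)
  qed
  have "(\<lambda>k. (sqrt (r k) - 1)\<^sup>2) \<longlonglongrightarrow> 0"
    by (rule tendsto_sandwich[OF _ _ tendsto_const assms(2)]) (auto intro: always_eventually le)
  then have "(\<lambda>k. sqrt (r k) - 1) \<longlonglongrightarrow> 0" by simp
  then have "(\<lambda>k. (sqrt (r k) - 1 + 1)\<^sup>2) \<longlonglongrightarrow> (0 + 1)\<^sup>2" by (intro tendsto_intros)
  moreover have "(sqrt (r k) - 1 + 1)\<^sup>2 = r k" for k using assms(1)[of k] by simp
  ultimately show ?thesis by simp
qed

text \<open>
  Summability of the errors bounds the total increase of the potential, and the potential is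
  bounded below, so the decreases tend to zero. Hence \<open>r\<^sub>k \<rightarrow> 1\<close> and \<open>c\<^sub>k \<rightarrow> 1\<close>, and the squared
  relative defect of \<open>B\<^sub>k s\<^sub>k = s\<^sub>k\<close> is \<open>c\<^sub>k (r\<^sub>k - 1)\<^sup>2 + (1 - c\<^sub>k)\<close>.
\<close>
lemma bfgs_dennis_more_identity:
  fixes B :: "nat \<Rightarrow> real^'n^'n"
  assumes B: "\<And>k. sym_pos_def (B k)" and upd: "\<And>k. B (Suc k) = bfgs_update (B k) (s k) (y k)"
    and s: "\<And>k. s k \<noteq> 0" and eps: "\<And>k. 0 \<le> \<epsilon> k" "\<And>k. \<epsilon> k \<le> 1/4" "summable \<epsilon>"
    and ys: "\<And>k. norm (y k - s k) \<le> \<epsilon> k * norm (s k)"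
  shows "(\<lambda>k. norm (B k *v s k - s k) / norm (s k)) \<longlonglongrightarrow> 0"
proof -
  define a n m where "a k = s k \<bullet> (B k *v s k)" and "n k = (norm (s k))\<^sup>2"
    and "m k = (norm (B k *v s k))\<^sup>2" for k
  define r c where "r k = m k / a k" and "c k = (a k)\<^sup>2 / (n k * m k)" for k
  have a: "0 < a k" for k using sym_pos_defD(2)[OF B s] by (simp add: a_def)
  have n: "0 < n k" for k using s by (simp add: n_def)
  have m: "0 < m k" for k using a[of k] by (auto simp: a_def m_def)
  have r: "0 < r k" for k using a m by (simp add: r_def)
  have c: "0 < c k" "c k \<le> 1" for k
  proof -
    show "0 < c k" using a n m by (simp add: c_def less_imp_neq[OF a, symmetric])
    have "(a k)\<^sup>2 \<le> n k * m k"
      unfolding a_def n_def m_def power2_norm_eq_inner by (rule Cauchy_Schwarz_ineq)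
    then show "c k \<le> 1" using n m by (simp add: c_def)
  qed
  have r_ln: "0 \<le> r k - 1 - ln (r k)" for k using ln_le_minus_one[OF r[of k]] by simp
  have c_ln: "0 \<le> - ln (c k)" for k using c[of k] by simp
  obtain K where K: "\<And>B :: real^'n^'n. sym_pos_def B \<Longrightarrow> K \<le> bfgs_potential B"
    using bfgs_potential_bounded_below[where 'n = 'n] by blast
  have t0: "(\<lambda>k. (r k - 1 - ln (r k)) - ln (c k)) \<longlonglongrightarrow> 0"
  proof (rule tendsto_zero_if_potential_decreases[where \<psi> = "\<lambda>k. bfgs_potential (B k)"
        and \<epsilon> = "\<lambda>k. 7 * \<epsilon> k" and K = K])
    fix k
    show "bfgs_potential (B (Suc k))
        \<le> bfgs_potential (B k) + 7 * \<epsilon> k - (r k - 1 - ln (r k) - ln (c k))"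
      unfolding upd r_def c_def m_def a_def n_def
      by (rule bfgs_potential_update_le[OF B s eps(1,2) ys])
    show "0 \<le> (r k - 1 - ln (r k)) - ln (c k)" using r_ln[of k] c_ln[of k] by simp
  qed (use eps K B in \<open>auto intro: summable_mult\<close>)
  have "r \<longlonglongrightarrow> 1"
  proof (rule tendsto_one_if_minus_ln_tendsto_zero[OF r])
    show "(\<lambda>k. r k - 1 - ln (r k)) \<longlonglongrightarrow> 0"
      using c_ln by (intro tendsto_sandwich[OF _ _ tendsto_const t0] always_eventually allI r_ln) simp
  qed
  have "(\<lambda>k. - ln (c k)) \<longlonglongrightarrow> 0"
  proof (intro tendsto_sandwich[OF _ _ tendsto_const t0] always_eventually allI c_ln)
    show "- ln (c k) \<le> r k - 1 - ln (r k) - ln (c k)" for k using r_ln[of k] by linarith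
  qed
  then have "(\<lambda>k. exp (- (- ln (c k)))) \<longlonglongrightarrow> exp (- 0)" by (intro tendsto_intros)
  then have "c \<longlonglongrightarrow> 1" using c(1) by simp
  have sq: "(norm (B k *v s k - s k) / norm (s k))\<^sup>2 = c k * (r k - 1)\<^sup>2 + (1 - c k)" for k
  proof -
    have "(norm (B k *v s k - s k))\<^sup>2 = m k - 2 * a k + n k"
      by (simp add: m_def a_def n_def power2_norm_eq_inner inner_diff_left inner_diff_right inner_commute)
    then have "(norm (B k *v s k - s k) / norm (s k))\<^sup>2 = (m k - 2 * a k + n k) / n k"
      by (simp add: power_divide n_def)
    also have "\<dots> = c k * (r k)\<^sup>2 - 2 * (c k * r k) + 1"
      using a[of k] n[of k] m[of k] by (simp add: c_def r_def field_simps power2_eq_square)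
    finally show ?thesis by (simp add: power2_diff algebra_simps)
  qed
  have "(\<lambda>k. (norm (B k *v s k - s k) / norm (s k))\<^sup>2) \<longlonglongrightarrow> 1 * (1 - 1)\<^sup>2 + (1 - 1)"
    unfolding sq by (intro tendsto_intros \<open>r \<longlonglongrightarrow> 1\<close> \<open>c \<longlonglongrightarrow> 1\<close>)
  then show ?thesis by simp
qed

text \<open>
  BFGS is invariant under linear changes of variables: steps transform by \<open>G\<close>, gradient
  differences by the inverse transpose of \<open>G\<close>, and the matrices as quadratic forms.
\<close>
lemma bfgs_update_change_of_variables:
  fixes B G J :: "real^'n^'n"
  assumes sym: "transpose B = B" and JG: "J ** G = mat 1"
  shows "bfgs_update (transpose J ** B ** J) (G *v s) (transpose J *v y)
    = transpose J ** bfgs_update B s y ** J"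
proof (subst matrix_eq, rule allI)
  fix v
  have sym': "transpose (transpose J ** B ** J) = transpose J ** B ** J"
    using sym by (simp add: matrix_transpose_mul matrix_mul_assoc)
  have JGs: "J *v (G *v s) = s" by (simp add: matrix_vector_mul_assoc JG)
  have Bs: "(transpose J ** B ** J) *v (G *v s) = transpose J *v (B *v s)"
    by (metis JGs matrix_vector_mul_assoc)
  have dual: "(transpose J *v u) \<bullet> w = u \<bullet> (J *v w)" for u w
    by (rule inner_matrix_transpose[symmetric])
  have den: "(G *v s) \<bullet> (transpose J *v (B *v s)) = s \<bullet> (B *v s)"
    by (metis JGs dual inner_commute)
  show "bfgs_update (transpose J ** B ** J) (G *v s) (transpose J *v y) *v v
    = (transpose J ** bfgs_update B s y ** J) *v v"
    unfolding bfgs_update_mult_vec[OF sym'] Bs dual den JGs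
    by (simp add: bfgs_update_mult_vec[OF sym] matrix_vector_mult_diff_distrib
        matrix_vector_right_distrib matrix_vector_mult_scaleR
        del: transpose_matrix_vector flip: matrix_vector_mul_assoc)
qed

text \<open>
  Byrd and Nocedal's theorem: if the secant pairs are consistent with a fixed matrix \<open>H\<close> up to
  relative errors with finite sum, the Dennis-More condition holds. Writing
  \<open>H = G\<^sup>T G\<close> and changing variables by \<open>G\<close> reduces it to \<open>H = I\<close>.
\<close>
theorem bfgs_dennis_more:
  fixes B :: "nat \<Rightarrow> real^'n^'n"
  assumes H: "sym_pos_def H"
    and B: "\<And>k. sym_pos_def (B k)" and upd: "\<And>k. B (Suc k) = bfgs_update (B k) (s k) (y k)"
    and s: "\<And>k. s k \<noteq> 0" and eps: "\<And>k. 0 \<le> \<epsilon> k" "summable \<epsilon>"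
    and ys: "\<And>k. norm (y k - H *v s k) \<le> \<epsilon> k * norm (s k)"
  shows "(\<lambda>k. norm ((B k - H) *v s k) / norm (s k)) \<longlonglongrightarrow> 0"
proof -
  obtain G :: "real^'n^'n" where G: "H = transpose G ** G" "invertible G"
    using sym_pos_def_cholesky[OF H] .
  then obtain J where J: "G ** J = mat 1" "J ** G = mat 1"
    by (auto simp: invertible_def)
  have GJ_T: "transpose G ** transpose J = mat 1" "transpose J ** transpose G = mat 1"
    using J by (metis matrix_transpose_mul transpose_mat)+
  obtain K1 where K1: "0 < K1" "\<And>v. norm (transpose J *v v) \<le> K1 * norm v"
    using matrix_vector_norm_bound[of "transpose J"] by blast
  obtain K2 where K2: "0 < K2" "\<And>v. norm (J *v v) \<le> K2 * norm v"
    using matrix_vector_norm_bound[of J] by blast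
  obtain K3 where K3: "0 < K3" "\<And>v. norm (transpose G *v v) \<le> K3 * norm v"
    using matrix_vector_norm_bound[of "transpose G"] by blast
  obtain K4 where K4: "0 < K4" "\<And>v. norm (G *v v) \<le> K4 * norm v"
    using matrix_vector_norm_bound[of G] by blast
  define B' s' y' \<epsilon>' where "B' k = transpose J ** B k ** J" and "s' k = G *v s k"
    and "y' k = transpose J *v y k" and "\<epsilon>' k = K1 * K2 * \<epsilon> k" for k
  have s'_s: "J *v s' k = s k" for k by (simp add: s'_def matrix_vector_mul_assoc J)
  have spd': "sym_pos_def (B' k)" for k
    unfolding B'_def using J by (intro sym_pos_def_congruence B) (auto simp: invertible_def)
  have upd': "B' (Suc k) = bfgs_update (B' k) (s' k) (y' k)" for k
    unfolding B'_def s'_def y'_def upd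
    by (rule bfgs_update_change_of_variables[OF sym_pos_defD(1)[OF B] J(2), symmetric])
  have s': "s' k \<noteq> 0" for k using s[of k] s'_s[of k] by auto
  have ys': "norm (y' k - s' k) \<le> \<epsilon>' k * norm (s' k)" for k
  proof -
    have "y' k - s' k = transpose J *v (y k - H *v s k)"
      by (simp add: y'_def s'_def G(1) matrix_vector_mult_diff_distrib matrix_vector_mul_assoc
          matrix_mul_assoc GJ_T del: transpose_matrix_vector)
    then have "norm (y' k - s' k) \<le> K1 * norm (y k - H *v s k)" using K1(2) by simp
    also have "\<dots> \<le> K1 * (\<epsilon> k * norm (s k))" using ys K1(1) by (intro mult_left_mono) auto
    also have "\<dots> \<le> K1 * (\<epsilon> k * (K2 * norm (s' k)))"
      using K2(2)[of "s' k"] K1(1) eps(1) by (intro mult_left_mono) (auto simp: s'_s)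
    finally show ?thesis by (simp add: \<epsilon>'_def mult_ac)
  qed
  have sum': "summable \<epsilon>'" unfolding \<epsilon>'_def using eps(2) by (rule summable_mult)
  have eps': "0 \<le> \<epsilon>' k" for k using K1(1) K2(1) eps(1) by (simp add: \<epsilon>'_def)
  \<comment> \<open>The estimate of the potential requires errors of at most \<open>1/4\<close>, which holds from some
    index on.\<close>
  obtain N where N: "\<And>k. k \<ge> N \<Longrightarrow> \<epsilon>' k \<le> 1/4"
  proof -
    have "eventually (\<lambda>k. \<epsilon>' k < 1/4) sequentially"
      using summable_LIMSEQ_zero[OF sum'] by (rule order_tendstoD) simp
    then show ?thesis using that by (auto simp: eventually_sequentially intro: less_imp_le)
  qed
  have "(\<lambda>k. norm (B' (k + N) *v s' (k + N) - s' (k + N)) / norm (s' (k + N))) \<longlonglongrightarrow> 0"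
    by (rule bfgs_dennis_more_identity[where y = "\<lambda>k. y' (k + N)" and \<epsilon> = "\<lambda>k. \<epsilon>' (k + N)"])
      (use spd' upd' s' eps' N ys' sum' in \<open>auto intro: summable_ignore_initial_segment\<close>)
  then have "(\<lambda>k. norm (B' k *v s' k - s' k) / norm (s' k)) \<longlonglongrightarrow> 0"
    by (rule LIMSEQ_offset)
  then have lim: "(\<lambda>k. K3 * K4 * (norm (B' k *v s' k - s' k) / norm (s' k))) \<longlonglongrightarrow> 0"
    by (rule tendsto_mult_right_zero)
  have bound: "norm ((B k - H) *v s k) / norm (s k)
      \<le> K3 * K4 * (norm (B' k *v s' k - s' k) / norm (s' k))" for k
  proof -
    have "transpose G *v (B' k *v s' k) = (transpose G ** transpose J) *v (B k *v (J *v s' k))"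
      by (simp add: B'_def del: transpose_matrix_vector flip: matrix_vector_mul_assoc)
    moreover have "H *v s k = transpose G *v s' k"
      by (simp add: G(1) s'_def del: transpose_matrix_vector flip: matrix_vector_mul_assoc)
    ultimately have "(B k - H) *v s k = transpose G *v (B' k *v s' k - s' k)"
      by (simp add: GJ_T s'_s matrix_vector_mult_diff_distrib matrix_vector_mult_diff_rdistrib
          del: transpose_matrix_vector)
    then have "norm ((B k - H) *v s k) \<le> K3 * norm (B' k *v s' k - s' k)" using K3(2) by simp
    moreover have "norm (s' k) / K4 \<le> norm (s k)"
      using K4 by (simp add: s'_def field_simps)
    ultimately have "norm ((B k - H) *v s k) / norm (s k)
        \<le> (K3 * norm (B' k *v s' k - s' k)) / (norm (s' k) / K4)"
      using s' K3(1) K4(1) by (intro frac_le) auto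
    then show ?thesis by (simp add: mult_ac)
  qed
  show ?thesis
    by (intro tendsto_sandwich[OF _ _ tendsto_const lim] always_eventually allI bound) simp
qed

section \<open>Derivatives of the smooth part\<close>

lemma directional_derivative_tendsto:
  fixes F :: "'a::real_normed_vector \<Rightarrow> 'b::real_normed_vector"
  assumes "(F has_derivative F') (at x)"
  shows "((\<lambda>t. (F (x + t *\<^sub>R v) - F x) /\<^sub>R t) \<longlongrightarrow> F' v) (at_right 0)"
proof -
  have lin: "F' (t *\<^sub>R v) = t *\<^sub>R F' v" for t
    using assms by (simp add: has_derivative_linear linear_scale)
  have "((\<lambda>t. x + t *\<^sub>R v) has_derivative (\<lambda>t. t *\<^sub>R v)) (at 0)"
    by (auto intro!: derivative_eq_intros)
  then have "((\<lambda>t. F (x + t *\<^sub>R v)) has_derivative (\<lambda>t. t *\<^sub>R F' v)) (at 0)"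
    using has_derivative_compose[of "\<lambda>t. x + t *\<^sub>R v" "\<lambda>t. t *\<^sub>R v" 0 UNIV F F'] assms
    by (simp add: lin)
  then have "((\<lambda>t. norm (F (x + t *\<^sub>R v) - F x - t *\<^sub>R F' v) / norm t) \<longlongrightarrow> 0) (at 0)"
    by (simp add: has_derivative_at)
  then have "((\<lambda>t. norm (F (x + t *\<^sub>R v) - F x - t *\<^sub>R F' v) / norm t) \<longlongrightarrow> 0) (at_right 0)"
    by (rule tendsto_mono[OF at_le[OF subset_UNIV]])
  moreover have "\<forall>\<^sub>F t in at_right 0. norm (F (x + t *\<^sub>R v) - F x - t *\<^sub>R F' v) / norm t
      = norm ((F (x + t *\<^sub>R v) - F x) /\<^sub>R t - F' v)"
    unfolding eventually_at_right_field
  proof (intro exI[of _ 1] conjI allI impI)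
    fix t :: real
    assume t: "0 < t"
    then have "(F (x + t *\<^sub>R v) - F x) /\<^sub>R t - F' v = (F (x + t *\<^sub>R v) - F x - t *\<^sub>R F' v) /\<^sub>R t"
      by (simp add: scaleR_diff_right)
    with t show "norm (F (x + t *\<^sub>R v) - F x - t *\<^sub>R F' v) / norm t
      = norm ((F (x + t *\<^sub>R v) - F x) /\<^sub>R t - F' v)"
      by (simp add: divide_inverse mult.commute)
  qed simp
  ultimately have "((\<lambda>t. norm ((F (x + t *\<^sub>R v) - F x) /\<^sub>R t - F' v)) \<longlongrightarrow> 0) (at_right 0)"
    by (rule Lim_transform_eventually)
  then show ?thesis by (rule LIM_zero_cancel[OF tendsto_norm_zero_cancel])
qed

lemma has_derivative_grad:
  fixes f :: "real^'n \<Rightarrow> real"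
  assumes "f differentiable (at x)"
  shows "(f has_derivative (\<lambda>h. h \<bullet> grad f x)) (at x)"
proof -
  obtain f' where f': "(f has_derivative f') (at x)"
    using assms by (auto simp: differentiable_def)
  have "f' h = h \<bullet> adjoint f' 1" for h
    using adjoint_works[OF has_derivative_linear[OF f'], of h 1] by simp
  then have "f' = (\<lambda>h. h \<bullet> adjoint f' 1)" by (rule ext)
  with f' have "(f has_derivative (\<lambda>h. h \<bullet> adjoint f' 1)) (at x)" by simp
  then have "GDERIV f x :> adjoint f' 1" by (simp add: gderiv_def)
  then show ?thesis using grad_eqI[of f x] by (simp add: gderiv_def)
qed

lemma twice_differentiableD:
  fixes f :: "real^'n \<Rightarrow> real"
  assumes "twice_differentiable f"
  shows "(f has_derivative (\<lambda>h. h \<bullet> grad f x)) (at x)"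
    and "(grad f has_derivative (\<lambda>h. hessian f x *v h)) (at x)"
proof -
  have "f differentiable (at x)" "grad f differentiable (at x)"
    using assms by (simp_all add: twice_differentiable_def)
  then show "(f has_derivative (\<lambda>h. h \<bullet> grad f x)) (at x)"
    and "(grad f has_derivative (\<lambda>h. hessian f x *v h)) (at x)"
    unfolding hessian_def by (auto simp only: jacobian_works intro: has_derivative_grad)
qed

text \<open>
  The numerator is the increment over \<open>[0, t]\<close> of \<open>r \<mapsto> f (x + r u + t v) - f (x + r u)\<close>. The
  mean value theorem expresses it by two values of the gradient near \<open>x\<close>, which are replaced by
  their linearizations at \<open>x\<close>.
\<close>
lemma second_difference_tendsto:
  fixes f :: "real^'n \<Rightarrow> real"
  assumes f: "twice_differentiable f"
  shows "((\<lambda>t. (f (x + t *\<^sub>R u + t *\<^sub>R v) - f (x + t *\<^sub>R u) - f (x + t *\<^sub>R v) + f x) / t\<^sup>2)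
    \<longlongrightarrow> u \<bullet> (hessian f x *v v)) (at_right 0)"
proof (rule tendstoI)
  fix e :: real
  assume e: "0 < e"
  let ?H = "hessian f x"
  define C where "C = norm u + norm v"
  have C: "0 \<le> C" by (simp add: C_def)
  define e' where "e' = e / (2 * C * norm u + 1)"
  have den: "0 < 2 * C * norm u + 1" using C by (simp add: add_nonneg_pos)
  then have e': "0 < e'" using e by (simp add: e'_def)
  obtain d where d: "0 < d"
    "\<And>z. norm (z - x) < d \<Longrightarrow> norm (grad f z - grad f x - ?H *v (z - x)) \<le> e' * norm (z - x)"
    using twice_differentiableD(2)[OF f, of x] e' unfolding has_derivative_at_alt by blast
  have bound: "dist ((f (x + t *\<^sub>R u + t *\<^sub>R v) - f (x + t *\<^sub>R u) - f (x + t *\<^sub>R v) + f x) / t\<^sup>2)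
      (u \<bullet> (?H *v v)) < e" if t: "0 < t" "t * (C + 1) < d" for t
  proof -
    define h where "h r = f (x + r *\<^sub>R u + t *\<^sub>R v) - f (x + r *\<^sub>R u)" for r
    have deriv: "DERIV h r :> u \<bullet> (grad f (x + r *\<^sub>R u + t *\<^sub>R v) - grad f (x + r *\<^sub>R u))" for r
    proof -
      have "((\<lambda>r. f (z + r *\<^sub>R u)) has_derivative (\<lambda>s. (s *\<^sub>R u) \<bullet> grad f (z + r *\<^sub>R u))) (at r)" for z
        by (rule has_derivative_compose[of "\<lambda>r. z + r *\<^sub>R u" "\<lambda>s. s *\<^sub>R u" r UNIV f,
              OF _ twice_differentiableD(1)[OF f]]) (auto intro!: derivative_eq_intros)
      note diff = has_derivative_diff[OF this[of "x + t *\<^sub>R v"] this[of x]]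
      have swap: "x + r *\<^sub>R u + t *\<^sub>R v = x + t *\<^sub>R v + r *\<^sub>R u" for r by simp
      show ?thesis
        unfolding has_field_derivative_def h_def swap
        by (rule has_derivative_eq_rhs[OF diff]) (simp add: fun_eq_iff inner_diff_right algebra_simps)
    qed
    obtain \<xi> where \<xi>: "0 < \<xi>" "\<xi> < t"
      "h t - h 0 = (t - 0) * (u \<bullet> (grad f (x + \<xi> *\<^sub>R u + t *\<^sub>R v) - grad f (x + \<xi> *\<^sub>R u)))"
      using MVT2[OF t(1), of h, OF deriv] by blast
    define R where "R z = grad f z - grad f x - ?H *v (z - x)" for z
    have near: "norm (R (x + w)) \<le> e' * (t * C)" if w: "norm w \<le> t * C" for w
    proof -
      have "norm w < d" using w t by (simp add: algebra_simps)
      then have "norm (R (x + w)) \<le> e' * norm w" using d(2)[of "x + w"] by (simp add: R_def)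
      also have "\<dots> \<le> e' * (t * C)" using w e' by (intro mult_left_mono) auto
      finally show ?thesis .
    qed
    have xu: "norm (\<xi> *\<^sub>R u) \<le> t * norm u" using \<xi> by (simp add: mult_right_mono)
    have n1: "norm (R (x + (\<xi> *\<^sub>R u + t *\<^sub>R v))) \<le> e' * (t * C)"
      using xu t norm_triangle_ineq[of "\<xi> *\<^sub>R u" "t *\<^sub>R v"]
      by (intro near) (simp add: C_def algebra_simps)
    have n2: "norm (R (x + \<xi> *\<^sub>R u)) \<le> e' * (t * C)"
    proof (rule near)
      have "t * norm u \<le> t * C" using t by (simp add: C_def)
      with xu show "norm (\<xi> *\<^sub>R u) \<le> t * C" by simp
    qed
    define D where "D = R (x + (\<xi> *\<^sub>R u + t *\<^sub>R v)) - R (x + \<xi> *\<^sub>R u)"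
    have "grad f (x + \<xi> *\<^sub>R u + t *\<^sub>R v) - grad f (x + \<xi> *\<^sub>R u) = t *\<^sub>R (?H *v v) + D"
      by (simp add: D_def R_def matrix_vector_right_distrib matrix_vector_mult_scaleR algebra_simps)
    then have "h t - h 0 = t * (u \<bullet> (t *\<^sub>R (?H *v v) + D))"
      using \<xi>(3) by simp
    also have "\<dots> = t\<^sup>2 * (u \<bullet> (?H *v v)) + t * (u \<bullet> D)"
      by (simp add: inner_add_right algebra_simps power2_eq_square)
    finally have "(h t - h 0) / t\<^sup>2 - u \<bullet> (?H *v v) = (u \<bullet> D) / t"
      using t by (simp add: field_simps power2_eq_square)
    moreover have "\<bar>u \<bullet> D\<bar> \<le> norm u * (2 * (e' * (t * C)))"
    proof -
      have "norm D \<le> 2 * (e' * (t * C))"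
        using n1 n2 norm_triangle_ineq4[of "R (x + (\<xi> *\<^sub>R u + t *\<^sub>R v))" "R (x + \<xi> *\<^sub>R u)"]
        by (simp add: D_def)
      then have "norm u * norm D \<le> norm u * (2 * (e' * (t * C)))" by (intro mult_left_mono) auto
      then show ?thesis using Cauchy_Schwarz_ineq2[of u D] by linarith
    qed
    moreover have "\<bar>(u \<bullet> D) / t\<bar> = \<bar>u \<bullet> D\<bar> / t" using t by simp
    ultimately have "\<bar>(h t - h 0) / t\<^sup>2 - u \<bullet> (?H *v v)\<bar> \<le> norm u * (2 * (e' * (t * C))) / t"
      using t by (simp only: divide_right_mono[OF _ less_imp_le])
    also have "\<dots> = norm u * (2 * (e' * C))" using t by simp
    also have "\<dots> = e' * (2 * C * norm u)" by simp
    also have "\<dots> < e' * (2 * C * norm u + 1)" using e' by simp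
    also have "\<dots> = e" using den by (simp add: e'_def)
    finally have "\<bar>(h t - h 0) / t\<^sup>2 - u \<bullet> (?H *v v)\<bar> < e" .
    moreover have "h t - h 0 = f (x + t *\<^sub>R u + t *\<^sub>R v) - f (x + t *\<^sub>R u) - f (x + t *\<^sub>R v) + f x"
      by (simp add: h_def)
    ultimately show ?thesis by (simp only: dist_real_def)
  qed
  show "\<forall>\<^sub>F t in at_right 0. dist ((f (x + t *\<^sub>R u + t *\<^sub>R v) - f (x + t *\<^sub>R u) - f (x + t *\<^sub>R v) + f x) / t\<^sup>2)
      (u \<bullet> (?H *v v)) < e"
    unfolding eventually_at_right_field
  proof (intro exI[of _ "d / (C + 1)"] conjI allI impI)
    show "0 < d / (C + 1)" using d C by (simp add: add_nonneg_pos)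
    fix t :: real
    assume "0 < t" "t < d / (C + 1)"
    then show "dist ((f (x + t *\<^sub>R u + t *\<^sub>R v) - f (x + t *\<^sub>R u) - f (x + t *\<^sub>R v) + f x) / t\<^sup>2)
      (u \<bullet> (?H *v v)) < e"
      using C by (intro bound) (simp_all add: pos_less_divide_eq add_nonneg_pos)
  qed
qed

text \<open>
  The second difference is symmetric in its two directions, hence so is its limit.
\<close>
lemma hessian_symmetric:
  assumes "twice_differentiable f"
  shows "transpose (hessian f x) = hessian f x"
proof (rule transpose_eq_if_inner_symmetric)
  fix u w
  have "((\<lambda>t. (f (x + t *\<^sub>R w + t *\<^sub>R u) - f (x + t *\<^sub>R w) - f (x + t *\<^sub>R u) + f x) / t\<^sup>2)
    \<longlongrightarrow> u \<bullet> (hessian f x *v w)) (at_right 0)"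
    using second_difference_tendsto[OF assms, of x u w] by (simp add: algebra_simps)
  then show "u \<bullet> (hessian f x *v w) = w \<bullet> (hessian f x *v u)"
    using second_difference_tendsto[OF assms, of x w u] tendsto_unique trivial_limit_at_right_real
    by blast
qed

text \<open>
  Divide the strong convexity inequality along the segment from \<open>x\<close> to \<open>z\<close> by \<open>t\<close> and let
  \<open>t\<close> tend to \<open>0\<close>.
\<close>
lemma strongly_convex_first_order:
  assumes f: "strongly_convex \<mu> f" "(f has_derivative (\<lambda>h. h \<bullet> D)) (at x)"
  shows "f x + (z - x) \<bullet> D + \<mu> / 2 * (norm (z - x))\<^sup>2 \<le> f z"
proof -
  define q where "q = (norm (z - x))\<^sup>2"
  have lim: "((\<lambda>t. (f (x + t *\<^sub>R (z - x)) - f x) /\<^sub>R t) \<longlongrightarrow> (z - x) \<bullet> D) (at_right 0)"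
    by (rule directional_derivative_tendsto[OF f(2)])
  have lim': "((\<lambda>t. f z - f x - \<mu> / 2 * (1 - t) * q) \<longlongrightarrow> f z - f x - \<mu> / 2 * (1 - 0) * q) (at_right 0)"
    by (intro tendsto_intros)
  have "\<forall>\<^sub>F t in at_right 0. (f (x + t *\<^sub>R (z - x)) - f x) /\<^sub>R t \<le> f z - f x - \<mu> / 2 * (1 - t) * q"
    unfolding eventually_at_right_field
  proof (intro exI[of _ 1] conjI allI impI)
    fix t :: real
    assume t: "0 < t" "t < 1"
    have "f ((1 - t) *\<^sub>R x + t *\<^sub>R z) \<le> (1 - t) * f x + t * f z - \<mu> / 2 * t * (1 - t) * q"
      unfolding q_def norm_minus_commute[of z x]
      using f(1)[unfolded strongly_convex_def, rule_format, of t x z] t by simp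
    moreover have "(1 - t) *\<^sub>R x + t *\<^sub>R z = x + t *\<^sub>R (z - x)" by (simp add: algebra_simps)
    moreover have "(1 - t) * f x + t * f z - \<mu> / 2 * t * (1 - t) * q
        = f x + (f z - f x - \<mu> / 2 * (1 - t) * q) * t"
      by (simp add: algebra_simps)
    ultimately have "f (x + t *\<^sub>R (z - x)) - f x \<le> (f z - f x - \<mu> / 2 * (1 - t) * q) * t"
      by simp
    moreover have "c /\<^sub>R t = c / t" for c :: real
      by (simp add: divide_inverse mult.commute)
    ultimately show "(f (x + t *\<^sub>R (z - x)) - f x) /\<^sub>R t \<le> f z - f x - \<mu> / 2 * (1 - t) * q"
      using t by (simp only: pos_divide_le_eq)
  qed simp
  with lim' lim have "(z - x) \<bullet> D \<le> f z - f x - \<mu> / 2 * (1 - 0) * q"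
    by (rule tendsto_le[OF trivial_limit_at_right_real])
  then show ?thesis unfolding q_def by (simp only: diff_zero mult_1_right)
qed

lemma strongly_convex_grad_monotone:
  assumes f: "strongly_convex \<mu> f" "twice_differentiable f"
  shows "\<mu> * (norm (a - b))\<^sup>2 \<le> (grad f a - grad f b) \<bullet> (a - b)"
proof -
  have ab: "f b + (a - b) \<bullet> grad f b + \<mu> / 2 * (norm (a - b))\<^sup>2 \<le> f a"
    by (rule strongly_convex_first_order[OF f(1) twice_differentiableD(1)[OF f(2)]])
  have "f a + (b - a) \<bullet> grad f a + \<mu> / 2 * (norm (b - a))\<^sup>2 \<le> f b"
    by (rule strongly_convex_first_order[OF f(1) twice_differentiableD(1)[OF f(2)]])
  moreover have "(b - a) \<bullet> grad f a = - ((a - b) \<bullet> grad f a)"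
    by (simp flip: inner_minus_left)
  moreover have "(grad f a - grad f b) \<bullet> (a - b) = (a - b) \<bullet> grad f a - (a - b) \<bullet> grad f b"
    by (metis inner_commute inner_diff_right)
  ultimately show ?thesis
    using ab by (simp only: norm_minus_commute[of b a])
qed

lemma strongly_convex_hessian:
  fixes f :: "real^'n \<Rightarrow> real"
  assumes f: "strongly_convex \<mu> f" "twice_differentiable f"
  shows "\<mu> * (norm v)\<^sup>2 \<le> v \<bullet> (hessian f x *v v)"
proof -
  have "((\<lambda>t. v \<bullet> ((grad f (x + t *\<^sub>R v) - grad f x) /\<^sub>R t)) \<longlongrightarrow> v \<bullet> (hessian f x *v v)) (at_right 0)"
    by (rule tendsto_inner[OF tendsto_const
          directional_derivative_tendsto[OF twice_differentiableD(2)[OF f(2)]]])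
  moreover have "\<forall>\<^sub>F t in at_right 0. \<mu> * (norm v)\<^sup>2 \<le> v \<bullet> ((grad f (x + t *\<^sub>R v) - grad f x) /\<^sub>R t)"
    unfolding eventually_at_right_field
  proof (intro exI[of _ 1] conjI allI impI)
    fix t :: real
    assume t: "0 < t"
    have "\<mu> * (norm (t *\<^sub>R v))\<^sup>2 \<le> (grad f (x + t *\<^sub>R v) - grad f x) \<bullet> (t *\<^sub>R v)"
      using strongly_convex_grad_monotone[OF f, of "x + t *\<^sub>R v" x]
      by (simp only: add_diff_cancel_left')
    moreover have "\<mu> * (norm (t *\<^sub>R v))\<^sup>2 = t * (\<mu> * (norm v)\<^sup>2 * t)"
      using t by (simp add: power2_eq_square)
    moreover have "(grad f (x + t *\<^sub>R v) - grad f x) \<bullet> (t *\<^sub>R v)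
        = t * (v \<bullet> (grad f (x + t *\<^sub>R v) - grad f x))"
      by (simp only: inner_scaleR_right inner_commute[of _ v])
    ultimately have "\<mu> * (norm v)\<^sup>2 * t \<le> v \<bullet> (grad f (x + t *\<^sub>R v) - grad f x)"
      using t by (simp only: mult_le_cancel_left_pos)
    moreover have "v \<bullet> (w /\<^sub>R t) = v \<bullet> w / t" for w
      by (simp only: inner_scaleR_right divide_inverse_commute)
    ultimately show "\<mu> * (norm v)\<^sup>2 \<le> v \<bullet> ((grad f (x + t *\<^sub>R v) - grad f x) /\<^sub>R t)"
      using t by (simp only: pos_le_divide_eq)
  qed simp
  ultimately show ?thesis
    by (rule tendsto_lowerbound) simp
qed

lemma sym_pos_def_hessian:
  assumes "strongly_convex \<mu> f" "twice_differentiable f" "0 < \<mu>"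
  shows "sym_pos_def (hessian f x)"
  unfolding sym_pos_def_def
proof (intro conjI allI impI hessian_symmetric assms)
  fix v :: "real^'a"
  assume "v \<noteq> 0"
  then have "0 < \<mu> * (norm v)\<^sup>2" using assms(3) by simp
  then show "0 < v \<bullet> (hessian f x *v v)"
    using strongly_convex_hessian[OF assms(1,2), of v x] by linarith
qed

text \<open>
  The function \<open>w \<mapsto> grad f w - hessian f c w\<close> has derivative at most \<open>L \<rho>\<close> on the ball of
  radius \<open>\<rho>\<close> about \<open>c\<close>, and the chosen \<open>\<rho>\<close> is large enough for the ball to contain \<open>y\<close> and \<open>z\<close>.
  When \<open>y\<close> and \<open>z\<close> are successive iterates and \<open>c\<close> is their limit, the factor is the relative
  secant error in \<open>bfgs_dennis_more\<close>.
\<close>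
lemma grad_linearization_bound:
  fixes f :: "real^'n \<Rightarrow> real"
  assumes f: "twice_differentiable f"
    and L: "0 \<le> L" "\<And>a b. op_norm (hessian f a - hessian f b) \<le> L * norm (a - b)"
  shows "norm (grad f z - grad f y - hessian f c *v (z - y))
    \<le> L * (norm (y - c) + norm (z - c)) * norm (z - y)"
proof -
  define \<rho> where "\<rho> = norm (y - c) + norm (z - c)"
  define \<phi> where "\<phi> w = grad f w - hessian f c *v w" for w
  have "norm (\<phi> z - \<phi> y) \<le> L * \<rho> * norm (z - y)"
  proof (rule differentiable_bound)
    show "convex (cball c \<rho>)" by (rule convex_cball)
    show "z \<in> cball c \<rho>" "y \<in> cball c \<rho>"
      by (simp_all add: \<rho>_def dist_norm norm_minus_commute)
    fix w
    assume w: "w \<in> cball c \<rho>"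
    have "(\<phi> has_derivative (\<lambda>h. hessian f w *v h - hessian f c *v h)) (at w)"
      unfolding \<phi>_def
      by (intro has_derivative_diff twice_differentiableD f bounded_linear_imp_has_derivative
          matrix_vector_mul_bounded_linear)
    then show "(\<phi> has_derivative (\<lambda>h. (hessian f w - hessian f c) *v h)) (at w within cball c \<rho>)"
      by (simp add: matrix_vector_mult_diff_rdistrib has_derivative_at_withinI)
    have "onorm (\<lambda>h. (hessian f w - hessian f c) *v h) \<le> L * norm (w - c)"
      using L(2)[of w c] by (simp add: op_norm_def)
    also have "\<dots> \<le> L * \<rho>"
      using w L(1) by (intro mult_left_mono) (auto simp: dist_norm norm_minus_commute)
    finally show "onorm (\<lambda>h. (hessian f w - hessian f c) *v h) \<le> L * \<rho>" .
  qed
  moreover have "\<phi> z - \<phi> y = grad f z - grad f y - hessian f c *v (z - y)"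
    by (simp add: \<phi>_def matrix_vector_mult_diff_distrib)
  ultimately show ?thesis by (simp only: \<rho>_def)
qed

section \<open>Subgradients and the proximal map\<close>

text \<open>
  Finiteness of \<open>h p\<close> is part of the definition because every vector would satisfy the
  inequality at a point where \<open>h\<close> is \<open>-\<infinity>\<close>.
\<close>
definition subdifferential :: "(real^'n \<Rightarrow> ereal) \<Rightarrow> real^'n \<Rightarrow> (real^'n) set" where
  "subdifferential h p = {v. \<bar>h p\<bar> \<noteq> \<infinity> \<and> (\<forall>z. h p + ereal (v \<bullet> (z - p)) \<le> h z)}"

lemma subdifferential_monotone:
  assumes a: "a \<in> subdifferential h p" and b: "b \<in> subdifferential h q"
  shows "0 \<le> (a - b) \<bullet> (p - q)"
proof -
  obtain \<alpha> \<beta> where eq: "h p = ereal \<alpha>" "h q = ereal \<beta>"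
    using a b by (auto simp: subdifferential_def)
  have "h p + ereal (a \<bullet> (q - p)) \<le> h q" "h q + ereal (b \<bullet> (p - q)) \<le> h p"
    using a b by (auto simp: subdifferential_def)
  then have "\<alpha> + a \<bullet> (q - p) \<le> \<beta>" "\<beta> + b \<bullet> (p - q) \<le> \<alpha>" by (simp_all add: eq)
  moreover have "a \<bullet> (q - p) = - (a \<bullet> (p - q))" by (simp flip: inner_minus_right)
  ultimately show ?thesis by (simp add: inner_diff_left)
qed

text \<open>
  Comparing \<open>p\<close> with \<open>p + t (z - p)\<close>, using convexity of \<open>h\<close>, dividing by \<open>t\<close> and letting \<open>t\<close>
  tend to \<open>0\<close> replaces \<open>\<phi>\<close> by its linearization. With \<open>\<phi> = f\<close> it gives the optimality condition at the minimizer of \<open>f + g\<close>; with \<open>\<phi>\<close> the squared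
  distance it characterizes the proximal point.
\<close>
lemma subgradient_of_composite_minimizer:
  fixes \<phi> :: "real^'n \<Rightarrow> real" and h :: "real^'n \<Rightarrow> ereal"
  assumes h: "proper h" "convex_fun h"
    and deriv: "(\<phi> has_derivative (\<lambda>d. d \<bullet> D)) (at p)"
    and min: "\<And>z. ereal (\<phi> p) + h p \<le> ereal (\<phi> z) + h z"
  shows "- D \<in> subdifferential h p"
proof -
  obtain z0 where "h z0 \<noteq> \<infinity>" using h(1) by (auto simp: proper_def)
  then have "h p \<noteq> \<infinity>" using min[of z0] by (cases "h z0") auto
  moreover have "h p \<noteq> - \<infinity>" using h(1) by (auto simp: proper_def)
  ultimately obtain c where c: "h p = ereal c" by (cases "h p") auto
  have "h p + ereal ((- D) \<bullet> (z - p)) \<le> h z" for z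
  proof (cases "h z")
    case (real b)
    have lim: "((\<lambda>t. (\<phi> (p + t *\<^sub>R (z - p)) - \<phi> p) /\<^sub>R t) \<longlongrightarrow> (z - p) \<bullet> D) (at_right 0)"
      by (rule directional_derivative_tendsto[OF deriv])
    have "\<forall>\<^sub>F t in at_right 0. c - b \<le> (\<phi> (p + t *\<^sub>R (z - p)) - \<phi> p) /\<^sub>R t"
      unfolding eventually_at_right_field
    proof (intro exI[of _ 1] conjI allI impI)
      fix t :: real
      assume t: "0 < t" "t < 1"
      define w where "w = p + t *\<^sub>R (z - p)"
      have w: "w = (1 - t) *\<^sub>R p + t *\<^sub>R z" by (simp add: w_def algebra_simps)
      have "h w \<le> ereal (1 - t) * h p + ereal t * h z"
        unfolding w using h(2)[unfolded convex_fun_def, rule_format, of t p z] t by simp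
      then have hw: "h w \<le> ereal ((1 - t) * c + t * b)" by (simp add: c real)
      have "ereal (\<phi> p) + h p \<le> ereal (\<phi> w) + h w" by (rule min)
      also have "\<dots> \<le> ereal (\<phi> w) + ereal ((1 - t) * c + t * b)"
        by (rule add_left_mono[OF hw])
      finally have "\<phi> p + c \<le> \<phi> w + ((1 - t) * c + t * b)" by (simp add: c)
      then have "(c - b) * t \<le> \<phi> w - \<phi> p" by (simp add: algebra_simps)
      then have "c - b \<le> (\<phi> w - \<phi> p) / t" using t by (simp only: pos_le_divide_eq)
      then show "c - b \<le> (\<phi> (p + t *\<^sub>R (z - p)) - \<phi> p) /\<^sub>R t"
        by (simp add: w_def divide_inverse mult.commute)
    qed simp
    then have "c - b \<le> (z - p) \<bullet> D" by (rule tendsto_lowerbound[OF lim]) simp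
    then show ?thesis by (simp add: c real inner_commute[of D])
  qed (use h(1) in \<open>auto simp: proper_def\<close>)
  then show ?thesis by (simp add: subdifferential_def c)
qed

text \<open>
  The subgradient inequality and the expansion of the square show that the proximal objective
  at \<open>z\<close> exceeds its value at \<open>p\<close> by at least \<open>|z - p|\<^sup>2 / 2\<close>, so \<open>p\<close> is its only minimizer.
\<close>
lemma prox_eqI:
  assumes sub: "x - p \<in> subdifferential h p"
  shows "prox h x = p"
proof -
  let ?\<Phi> = "\<lambda>y. h y + ereal ((norm (y - x))\<^sup>2 / 2)"
  obtain c where c: "h p = ereal c" using sub by (auto simp: subdifferential_def)
  have strict: "?\<Phi> p + ereal ((norm (z - p))\<^sup>2 / 2) \<le> ?\<Phi> z" for z
  proof -
    have "(norm (z - x))\<^sup>2 = (norm ((z - p) - (x - p)))\<^sup>2" by simp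
    also have "\<dots> = (norm (z - p))\<^sup>2 - 2 * ((x - p) \<bullet> (z - p)) + (norm (p - x))\<^sup>2"
      unfolding norm_minus_commute[of p x] power2_norm_eq_inner[of "z - p - (x - p)"]
        power2_norm_eq_inner[of "z - p"] power2_norm_eq_inner[of "x - p"]
      by (simp only: inner_diff_left[of "z - p"] inner_diff_right[of _ "z - p"] inner_commute[of "z - p" "x - p"])
    finally have sq: "(norm (p - x))\<^sup>2 / 2 + (norm (z - p))\<^sup>2 / 2
        = (x - p) \<bullet> (z - p) + (norm (z - x))\<^sup>2 / 2" by (simp add: field_simps)
    have "?\<Phi> p + ereal ((norm (z - p))\<^sup>2 / 2) = ereal c + ereal ((norm (p - x))\<^sup>2 / 2 + (norm (z - p))\<^sup>2 / 2)"
      by (simp add: c add.assoc)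
    also have "\<dots> = (h p + ereal ((x - p) \<bullet> (z - p))) + ereal ((norm (z - x))\<^sup>2 / 2)"
      unfolding sq by (simp add: c add.assoc)
    also have "\<dots> \<le> ?\<Phi> z"
      using sub by (intro add_right_mono) (auto simp: subdifferential_def)
    finally show ?thesis .
  qed
  have min: "is_arg_min ?\<Phi> (\<lambda>_. True) p"
  proof -
    have "?\<Phi> p \<le> ?\<Phi> z" for z
      using order_trans[OF _ strict[of z], of "?\<Phi> p"] by (simp add: c)
    then show ?thesis by (simp add: is_arg_min_linorder)
  qed
  then have "is_arg_min ?\<Phi> (\<lambda>_. True) (prox h x)"
    unfolding prox_def arg_min_def by (rule someI)
  then have "?\<Phi> (prox h x) \<le> ?\<Phi> p" by (simp add: is_arg_min_linorder)
  with strict[of "prox h x"] have "?\<Phi> p + ereal ((norm (prox h x - p))\<^sup>2 / 2) \<le> ?\<Phi> p"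
    by (rule order_trans)
  then show ?thesis by (simp add: c)
qed

text \<open>
  A bound \<open>h y\<^sub>n \<le> r\<^sub>n\<close> with \<open>r\<^sub>n \<rightarrow> r\<close> puts almost all \<open>y\<^sub>n\<close> into the sublevel set of \<open>r + d\<close>, for
  every \<open>d > 0\<close>.
\<close>
lemma closed_epigraph:
  fixes h :: "real^'n \<Rightarrow> ereal"
  assumes "closed_fun h"
  shows "closed {(y, r). h y \<le> ereal r}"
  unfolding closed_sequential_limits
proof (intro allI impI, elim conjE)
  fix w :: "nat \<Rightarrow> (real^'n) \<times> real" and l
  assume w: "\<forall>n. w n \<in> {(y, r). h y \<le> ereal r}" and l: "w \<longlonglongrightarrow> l"
  have yl: "(\<lambda>n. fst (w n)) \<longlonglongrightarrow> fst l" and rl: "(\<lambda>n. snd (w n)) \<longlonglongrightarrow> snd l"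
    using l by (auto intro: tendsto_fst tendsto_snd)
  have "h (fst l) \<le> ereal (snd l) + ereal d" if d: "0 < d" for d
  proof -
    have ev: "\<forall>\<^sub>F n in sequentially. fst (w n) \<in> {y. h y \<le> ereal (snd l + d)}"
    proof -
      have "\<forall>\<^sub>F n in sequentially. snd (w n) < snd l + d"
        using rl d by (intro order_tendstoD) auto
      then show ?thesis
      proof eventually_elim
        case (elim n)
        have "h (fst (w n)) \<le> ereal (snd (w n))" using w by (auto simp: case_prod_beta)
        also have "\<dots> \<le> ereal (snd l + d)" using elim by simp
        finally show ?case by simp
      qed
    qed
    have "fst l \<in> {y. h y \<le> ereal (snd l + d)}"
      by (rule Lim_in_closed_set[OF _ ev _ yl]) (use assms in \<open>auto simp: closed_fun_def\<close>)
    then show ?thesis by simp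
  qed
  then have "h (fst l) \<le> ereal (snd l)" by (rule ereal_le_epsilon2)
  then show "l \<in> {(y, r). h y \<le> ereal r}" by (simp add: case_prod_beta)
qed

text \<open>
  On the epigraph the objective becomes the continuous function \<open>(y, r) \<mapsto> r + |y - x|\<^sup>2 / 2\<close>.
  A subgradient at one point bounds \<open>r\<close> below by an affine function of \<open>y\<close>, so the quadratic
  term confines the relevant part of the epigraph to a compact set.
\<close>
lemma prox_objective_attains_min:
  fixes h :: "real^'n \<Rightarrow> ereal"
  assumes h: "proper h" "closed_fun h" and sub: "v \<in> subdifferential h p0"
  obtains p where "\<And>z. ereal ((norm (p - x))\<^sup>2 / 2) + h p \<le> ereal ((norm (z - x))\<^sup>2 / 2) + h z"
proof -
  obtain c0 where c0: "h p0 = ereal c0" using sub by (auto simp: subdifferential_def)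
  define \<Phi> where "\<Phi> w = snd w + (norm (fst w - x))\<^sup>2 / 2" for w :: "(real^'n) \<times> real"
  define \<Phi>0 where "\<Phi>0 = \<Phi> (p0, c0)"
  define a where "a = norm v"
  define lo where "lo = c0 + v \<bullet> (x - p0)"
  define R where "R = a + sqrt (a\<^sup>2 + 2 * \<bar>\<Phi>0 - lo\<bar>)"
  define T where "T = {(y, r). h y \<le> ereal r} \<inter> (cball x R \<times> {lo - a * R..\<Phi>0})"
  have a0: "0 \<le> a" by (simp add: a_def)
  have in_T: "(y, r) \<in> T" if "h y \<le> ereal r" "\<Phi> (y, r) \<le> \<Phi>0" for y r
  proof -
    define \<rho> where "\<rho> = norm (y - x)"
    have "h p0 + ereal (v \<bullet> (y - p0)) \<le> ereal r"
      using sub that(1) by (auto simp: subdifferential_def intro: order_trans)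
    then have "c0 + v \<bullet> (y - p0) \<le> r" by (simp add: c0)
    moreover have "v \<bullet> (y - p0) = v \<bullet> (y - x) + v \<bullet> (x - p0)"
      by (simp flip: inner_add_right)
    moreover have "- (a * \<rho>) \<le> v \<bullet> (y - x)"
      using Cauchy_Schwarz_ineq2[of v "y - x"] by (simp add: a_def \<rho>_def)
    ultimately have r: "lo - a * \<rho> \<le> r" by (simp add: lo_def)
    have r': "r + \<rho>\<^sup>2 / 2 \<le> \<Phi>0" using that(2) by (simp add: \<Phi>_def \<rho>_def)
    \<comment> \<open>The bounds on \<open>r\<close> give \<open>\<rho>\<^sup>2 / 2 - a \<rho> \<le> \<Phi>0 - lo\<close>; completing the square bounds \<open>\<rho>\<close>.\<close>
    have "(\<rho> - a)\<^sup>2 = \<rho>\<^sup>2 - 2 * (a * \<rho>) + a\<^sup>2" by (simp add: power2_diff)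
    also have "\<dots> \<le> a\<^sup>2 + 2 * \<bar>\<Phi>0 - lo\<bar>" using r r' abs_ge_self[of "\<Phi>0 - lo"] by argo
    finally have "\<bar>\<rho> - a\<bar> \<le> sqrt (a\<^sup>2 + 2 * \<bar>\<Phi>0 - lo\<bar>)" by (intro real_le_rsqrt) simp
    then have \<rho>R: "\<rho> \<le> R" by (simp add: R_def)
    then have "a * \<rho> \<le> a * R" using a0 by (rule mult_left_mono)
    moreover have "r \<le> \<Phi>0" using r' zero_le_power2[of \<rho>] by linarith
    ultimately show ?thesis
      using that(1) r \<rho>R by (simp add: T_def \<rho>_def dist_norm norm_minus_commute)
  qed
  have "compact T"
    unfolding T_def by (intro closed_Int_compact closed_epigraph h compact_Times) auto
  moreover have p0T: "(p0, c0) \<in> T" by (intro in_T) (simp_all add: c0 \<Phi>0_def)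
  moreover have "continuous_on T \<Phi>" unfolding \<Phi>_def by (intro continuous_intros) auto
  ultimately obtain w where w: "w \<in> T" "\<And>w'. w' \<in> T \<Longrightarrow> \<Phi> w \<le> \<Phi> w'"
    using continuous_attains_inf[of T \<Phi>] by blast
  define p r where "p = fst w" and "r = snd w"
  have hp: "h p \<le> ereal r" using w(1) by (auto simp: T_def p_def r_def)
  show ?thesis
  proof (rule that)
    fix z
    show "ereal ((norm (p - x))\<^sup>2 / 2) + h p \<le> ereal ((norm (z - x))\<^sup>2 / 2) + h z"
    proof (cases "h z")
      case (real b)
      have "\<Phi> w \<le> \<Phi> (z, b)"
      proof (cases "\<Phi> (z, b) \<le> \<Phi>0")
        case True
        then show ?thesis by (intro w(2) in_T) (simp_all add: real)
      next
        case False
        then show ?thesis using w(2)[OF p0T] by (simp add: \<Phi>0_def)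
      qed
      then have le: "(norm (p - x))\<^sup>2 / 2 + r \<le> (norm (z - x))\<^sup>2 / 2 + b"
        by (simp add: \<Phi>_def p_def r_def)
      have "ereal ((norm (p - x))\<^sup>2 / 2) + h p \<le> ereal ((norm (p - x))\<^sup>2 / 2) + ereal r"
        by (rule add_left_mono[OF hp])
      also have "\<dots> \<le> ereal ((norm (z - x))\<^sup>2 / 2) + h z" using le by (simp add: real)
      finally show ?thesis .
    qed (use h(1) in \<open>auto simp: proper_def\<close>)
  qed
qed

lemma prox_subgradient:
  fixes h :: "real^'n \<Rightarrow> ereal"
  assumes h: "proper h" "closed_fun h" "convex_fun h" and sub: "v \<in> subdifferential h p0"
  shows "x - prox h x \<in> subdifferential h (prox h x)"
proof -
  obtain p where p: "\<And>z. ereal ((norm (p - x))\<^sup>2 / 2) + h p \<le> ereal ((norm (z - x))\<^sup>2 / 2) + h z"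
    using prox_objective_attains_min[OF h(1,2) sub] by blast
  have "((\<lambda>y. (norm (y - x))\<^sup>2 / 2) has_derivative (\<lambda>d. d \<bullet> (p - x))) (at p)"
    unfolding power2_norm_eq_inner
    by (auto intro!: derivative_eq_intros simp: inner_commute)
  then have "- (p - x) \<in> subdifferential h p"
    by (rule subgradient_of_composite_minimizer[OF h(1,3) _ p])
  then have "x - p \<in> subdifferential h p" by simp
  with prox_eqI[OF this] show ?thesis by simp
qed

text \<open>
  Monotonicity of the subdifferential at the two proximal points.
\<close>
lemma prox_firmly_nonexpansive:
  fixes h :: "real^'n \<Rightarrow> ereal"
  assumes "proper h" "closed_fun h" "convex_fun h" "v \<in> subdifferential h p0"
  shows "(norm (prox h a - prox h b))\<^sup>2 \<le> (a - b) \<bullet> (prox h a - prox h b)"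
  using subdifferential_monotone[OF prox_subgradient[OF assms, of a] prox_subgradient[OF assms, of b]]
  by (simp add: power2_norm_eq_inner inner_diff_left)

text \<open>
  Firm nonexpansiveness passes to difference quotients, hence to Jacobians, hence to their limits.
  For symmetric \<open>V\<close> the conclusion says that the spectrum lies in \<open>[0, 1]\<close>.
\<close>
lemma B_subdifferential_firm:
  fixes F :: "real^'n \<Rightarrow> real^'n"
  assumes firm: "\<And>a b. (norm (F a - F b))\<^sup>2 \<le> (a - b) \<bullet> (F a - F b)"
    and V: "V \<in> B_subdifferential F x"
  shows "(norm (V *v w))\<^sup>2 \<le> w \<bullet> (V *v w)"
proof -
  obtain z where z: "\<And>k. F differentiable (at (z k))" "(\<lambda>k. jacobian F (at (z k))) \<longlonglongrightarrow> V"
    using V by (auto simp: B_subdifferential_def)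
  have jac: "(norm (jacobian F (at y) *v w))\<^sup>2 \<le> w \<bullet> (jacobian F (at y) *v w)"
    if "F differentiable (at y)" for y
  proof -
    let ?q = "\<lambda>t. (F (y + t *\<^sub>R w) - F y) /\<^sub>R t"
    have lim: "(?q \<longlongrightarrow> jacobian F (at y) *v w) (at_right 0)"
      using that directional_derivative_tendsto by (simp only: jacobian_works)
    have "\<forall>\<^sub>F t in at_right 0. (norm (?q t))\<^sup>2 \<le> w \<bullet> ?q t"
      unfolding eventually_at_right_field
    proof (intro exI[of _ 1] conjI allI impI)
      fix t :: real
      assume t: "0 < t"
      define d where "d = F (y + t *\<^sub>R w) - F y"
      have "(norm d)\<^sup>2 \<le> t * (w \<bullet> d)"
        using firm[of "y + t *\<^sub>R w" y] by (simp add: d_def)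
      then have "inverse t * (norm d)\<^sup>2 \<le> w \<bullet> d" using t by (simp add: field_simps)
      then show "(norm (?q t))\<^sup>2 \<le> w \<bullet> ?q t"
        using t by (simp add: power_mult_distrib power2_eq_square divide_inverse mult_ac flip: d_def)
    qed simp
    then show ?thesis
      by (rule tendsto_le[OF trivial_limit_at_right_real tendsto_inner[OF tendsto_const lim]
            tendsto_power[OF tendsto_norm[OF lim]]])
  qed
  have lim: "(\<lambda>k. jacobian F (at (z k)) *v w) \<longlonglongrightarrow> V *v w"
    unfolding matrix_vector_mult_def
    by (intro vec_tendstoI) (auto intro!: tendsto_intros z(2))
  show ?thesis
    by (rule LIMSEQ_le[OF tendsto_power[OF tendsto_norm[OF lim]]
          tendsto_inner[OF tendsto_const lim]]) (use jac[OF z(1)] in auto)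
qed

lemma proper_scaled:
  assumes "proper g" "0 < \<nu>"
  shows "proper (\<lambda>y. ereal \<nu> * g y)"
proof -
  have *: "(ereal \<nu> * r = \<infinity>) = (r = \<infinity>)" "(ereal \<nu> * r = - \<infinity>) = (r = - \<infinity>)" for r
    using assms(2) by (cases r; simp)+
  show ?thesis using assms(1) unfolding proper_def * .
qed

lemma closed_fun_scaled:
  assumes "closed_fun g" "0 < \<nu>"
  shows "closed_fun (\<lambda>y. ereal \<nu> * g y)"
proof -
  have *: "(ereal \<nu> * r \<le> ereal c) = (r \<le> ereal (c / \<nu>))" for r c
    using assms(2) by (cases r) (auto simp: field_simps)
  show ?thesis using assms(1) by (simp add: closed_fun_def *)
qed

lemma convex_fun_scaled:
  assumes g: "convex_fun g" "proper g" and nu: "0 < \<nu>"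
  shows "convex_fun (\<lambda>y. ereal \<nu> * g y)"
  unfolding convex_fun_def
proof (intro allI impI)
  fix x y :: "real^'a" and t :: real
  assume t: "0 \<le> t \<and> t \<le> 1"
  have "ereal \<nu> * g ((1 - t) *\<^sub>R x + t *\<^sub>R y) \<le> ereal \<nu> * (ereal (1 - t) * g x + ereal t * g y)"
    using g(1)[unfolded convex_fun_def, rule_format, OF t] nu by (intro ereal_mult_left_mono) auto
  also have "\<dots> = ereal (1 - t) * (ereal \<nu> * g x) + ereal t * (ereal \<nu> * g y)"
  proof -
    have finite_below: "ereal s * g z \<noteq> - \<infinity>" if "0 \<le> s" for s z
      using that g(2) by (cases "g z") (auto simp: proper_def)
    have "ereal (1 - t) * g x \<noteq> - \<infinity>" "ereal t * g y \<noteq> - \<infinity>"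
      by (rule finite_below, use t in simp)+
    then have "ereal \<nu> * (ereal (1 - t) * g x + ereal t * g y)
        = ereal \<nu> * (ereal (1 - t) * g x) + ereal \<nu> * (ereal t * g y)"
      by (intro ereal_distrib_left) (blast, blast, simp)
    then show ?thesis by (simp only: mult.left_commute[of "ereal \<nu>"])
  qed
  finally show "ereal \<nu> * g ((1 - t) *\<^sub>R x + t *\<^sub>R y)
    \<le> ereal (1 - t) * (ereal \<nu> * g x) + ereal t * (ereal \<nu> * g y)" .
qed

lemma subdifferential_scaled:
  assumes "v \<in> subdifferential g p" "0 < \<nu>"
  shows "\<nu> *\<^sub>R v \<in> subdifferential (\<lambda>y. ereal \<nu> * g y) p"
proof -
  obtain c where c: "g p = ereal c" using assms(1) by (auto simp: subdifferential_def)
  have "ereal \<nu> * g p + ereal ((\<nu> *\<^sub>R v) \<bullet> (z - p)) \<le> ereal \<nu> * g z" for z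
  proof -
    have "ereal \<nu> * (g p + ereal (v \<bullet> (z - p))) \<le> ereal \<nu> * g z"
      using assms by (intro ereal_mult_left_mono) (auto simp: subdifferential_def)
    then show ?thesis by (simp add: c distrib_left)
  qed
  then show ?thesis by (simp add: subdifferential_def c)
qed

section \<open>The Newton systems of the method\<close>

text \<open>
  Let \<open>r\<close> be the image of \<open>w\<close> and \<open>b = \<nu> B w\<close>. Then \<open>V (w - b) = w - r\<close>, and the firmness of \<open>V\<close>
  at \<open>w - b\<close> reads \<open>|w - r|\<^sup>2 \<le> (w - b) \<bullet> (w - r)\<close>. Expanding it gives the claim. Applied to
  \<open>B\<^sub>k\<close> this makes the Newton system solvable; applied to the Hessian it bounds the inverse.
\<close>
lemma newton_matrix_inequality:
  fixes V B :: "real^'n^'n"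
  assumes firm: "\<And>p. (norm (V *v p))\<^sup>2 \<le> p \<bullet> (V *v p)"
  shows "\<nu> * (w \<bullet> (B *v w))
    \<le> (w + \<nu> *\<^sub>R (B *v w)) \<bullet> ((mat 1 - V ** (mat 1 - \<nu> *\<^sub>R B)) *v w)"
proof -
  define b where "b = \<nu> *\<^sub>R (B *v w)"
  define r where "r = (mat 1 - V ** (mat 1 - \<nu> *\<^sub>R B)) *v w"
  have "r = w - V *v (w - b)"
    by (simp add: r_def b_def matrix_vector_mult_diff_rdistrib scaleR_matrix_vector_assoc
        flip: matrix_vector_mul_assoc)
  then have "V *v (w - b) = w - r" by simp
  then have "(w - r) \<bullet> (w - r) \<le> (w - b) \<bullet> (w - r)"
    using firm[of "w - b"] by (simp add: power2_norm_eq_inner)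
  then have "w \<bullet> b \<le> (w + b) \<bullet> r - r \<bullet> r"
    by (simp add: inner_diff_left inner_diff_right inner_add_left inner_add_right inner_commute)
  then have "w \<bullet> b \<le> (w + b) \<bullet> r" using inner_ge_zero[of r] by linarith
  then show ?thesis by (simp add: b_def r_def)
qed

lemma newton_matrix_invertible:
  fixes V B :: "real^'n^'n"
  assumes "\<And>p. (norm (V *v p))\<^sup>2 \<le> p \<bullet> (V *v p)" "sym_pos_def B" "0 < \<nu>"
  shows "invertible (mat 1 - V ** (mat 1 - \<nu> *\<^sub>R B))"
proof -
  have "w = 0" if "(mat 1 - V ** (mat 1 - \<nu> *\<^sub>R B)) *v w = 0" for w
  proof (rule ccontr)
    assume "w \<noteq> 0"
    then have "0 < \<nu> * (w \<bullet> (B *v w))" using sym_pos_defD(2)[OF assms(2)] assms(3) by simp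
    then show False using newton_matrix_inequality[OF assms(1), of \<nu> w B] that by simp
  qed
  then show ?thesis by (metis invertible_left_inverse matrix_left_invertible_ker)
qed

text \<open>
  The constant has to be independent of \<open>V\<close>, since the method chooses \<open>V\<close> anew at every
  iteration.
\<close>
lemma newton_matrix_uniform_lower_bound:
  fixes H :: "real^'n^'n"
  assumes H: "\<And>v. \<mu> * (norm v)\<^sup>2 \<le> v \<bullet> (H *v v)" and pos: "0 < \<mu>" "0 < \<nu>"
  obtains C where "0 < C"
    "\<And>V w. (\<And>p. (norm (V *v p))\<^sup>2 \<le> p \<bullet> (V *v p))
       \<Longrightarrow> norm w \<le> C * norm ((mat 1 - V ** (mat 1 - \<nu> *\<^sub>R H)) *v w)"
proof -
  obtain K where K: "0 < K" "\<And>v. norm (H *v v) \<le> K * norm v"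
    using matrix_vector_norm_bound[of H] by blast
  define C where "C = (1 + \<nu> * K) / (\<nu> * \<mu>)"
  have C: "0 < C" using K pos by (simp add: C_def add_pos_pos)
  show ?thesis
  proof (rule that[OF C])
    fix V :: "real^'n^'n" and w
    assume firm: "\<And>p. (norm (V *v p))\<^sup>2 \<le> p \<bullet> (V *v p)"
    define r where "r = (mat 1 - V ** (mat 1 - \<nu> *\<^sub>R H)) *v w"
    have "\<nu> * (\<mu> * (norm w)\<^sup>2) \<le> \<nu> * (w \<bullet> (H *v w))"
      using H pos by (intro mult_left_mono) auto
    also have "\<dots> \<le> (w + \<nu> *\<^sub>R (H *v w)) \<bullet> r"
      unfolding r_def by (rule newton_matrix_inequality[OF firm])
    also have "\<dots> \<le> norm (w + \<nu> *\<^sub>R (H *v w)) * norm r" by (rule norm_cauchy_schwarz)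
    also have "\<dots> \<le> ((1 + \<nu> * K) * norm w) * norm r"
    proof (rule mult_right_mono)
      have "norm (w + \<nu> *\<^sub>R (H *v w)) \<le> norm w + \<nu> * norm (H *v w)"
        using norm_triangle_ineq[of w "\<nu> *\<^sub>R (H *v w)"] pos by simp
      also have "\<dots> \<le> norm w + \<nu> * (K * norm w)"
        using K(2)[of w] pos by (intro add_left_mono mult_left_mono) auto
      finally show "norm (w + \<nu> *\<^sub>R (H *v w)) \<le> (1 + \<nu> * K) * norm w"
        by (simp add: algebra_simps)
    qed simp
    finally have *: "norm w * (\<nu> * \<mu> * norm w) \<le> norm w * ((1 + \<nu> * K) * norm r)"
      by (simp add: power2_eq_square mult_ac)
    have "\<nu> * \<mu> * norm w \<le> (1 + \<nu> * K) * norm r"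
    proof (cases "w = 0")
      case True
      then show ?thesis using K pos by simp
    next
      case False
      then have "0 < norm w" by simp
      then show ?thesis using * by (simp only: mult_le_cancel_left_pos)
    qed
    then show "norm w \<le> C * norm ((mat 1 - V ** (mat 1 - \<nu> *\<^sub>R H)) *v w)"
      using pos unfolding C_def r_def by (simp add: field_simps)
  qed
qed

text \<open>
  Invertibility has to be known before the step can be read as the solution of a linear system,
  as \<open>matrix_inv\<close> is unspecified on singular matrices.
\<close>
lemma hybrid_step:
  assumes "hybrid_linear_quasi_newton f g \<nu> x B" "1 \<le> k"
    and inv: "\<And>V. V \<in> B_subdifferential (prox_scaled \<nu> g) (x k - \<nu> *\<^sub>R grad f (x k))
      \<Longrightarrow> invertible (mat 1 - V ** (mat 1 - \<nu> *\<^sub>R B k))"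
  obtains V where "V \<in> B_subdifferential (prox_scaled \<nu> g) (x k - \<nu> *\<^sub>R grad f (x k))"
    "(mat 1 - V ** (mat 1 - \<nu> *\<^sub>R B k)) *v (x (k + 1) - x k) = - prox_residual f g \<nu> (x k)"
proof -
  obtain V where V: "V \<in> B_subdifferential (prox_scaled \<nu> g) (x k - \<nu> *\<^sub>R grad f (x k))"
    "x (k + 1) = x k + - (matrix_inv (mat 1 - V ** (mat 1 - \<nu> *\<^sub>R B k)) *v prox_residual f g \<nu> (x k))"
    using assms(1,2) unfolding hybrid_linear_quasi_newton_def Let_def by blast
  define M where "M = mat 1 - V ** (mat 1 - \<nu> *\<^sub>R B k)"
  have "M ** matrix_inv M = mat 1"
    using someI_ex[OF inv[OF V(1), unfolded invertible_def]] by (simp add: matrix_inv_def M_def)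
  then have "M *v (x (k + 1) - x k) = - prox_residual f g \<nu> (x k)"
    unfolding V(2) M_def[symmetric]
    by (simp add: matrix_vector_mul_assoc vec.neg)
  with V(1) show ?thesis using that by (simp add: M_def)
qed

lemma hybrid_matrices_sym_pos_def:
  assumes hyb: "hybrid_linear_quasi_newton f g \<nu> x B"
    and f: "strongly_convex \<mu> f" "twice_differentiable f" "0 < \<mu>"
  shows "1 \<le> k \<Longrightarrow> sym_pos_def (B k)"
proof (induction k rule: nat_induct_at_least)
  case base
  then show ?case using hyb by (simp add: hybrid_linear_quasi_newton_def)
next
  case (Suc k)
  define s y where "s = x (k + 1) - x k" and "y = grad f (x (k + 1)) - grad f (x k)"
  have upd: "B (Suc k) = bfgs_update (B k) s y"
    using hyb Suc.hyps by (simp add: hybrid_linear_quasi_newton_def Let_def s_def y_def)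
  \<comment> \<open>A vanishing step leaves \<open>B\<close> unchanged, because both quotients in the update have a zero
    denominator and therefore the value \<open>0\<close>.\<close>
  show ?case
  proof (cases "s = 0")
    case True
    then have "s = 0" "y = 0" by (simp_all add: s_def y_def)
    then have "B (Suc k) = B k" by (simp add: upd bfgs_update_def)
    then show ?thesis using Suc.IH by simp
  next
    case False
    then have "0 < \<mu> * (norm s)\<^sup>2" using f(3) by simp
    also have "\<dots> \<le> y \<bullet> s"
      unfolding s_def y_def by (rule strongly_convex_grad_monotone[OF f(1,2)])
    finally show ?thesis unfolding upd by (rule sym_pos_def_bfgs_update[OF Suc.IH False])
  qed
qed

section \<open>Characterization of superlinear convergence\<close>

lemma superlinear_summable:
  fixes x :: "nat \<Rightarrow> real^'n"
  assumes "superlinear_convergence x l" "\<And>k. 1 \<le> k \<Longrightarrow> x k \<noteq> l"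
  shows "summable (\<lambda>k. norm (x k - l))"
    and "\<forall>\<^sub>F k in sequentially. x (k + 1) \<noteq> x k"
proof -
  have "\<forall>\<^sub>F k in sequentially. norm (x (k + 1) - l) / norm (x k - l) < 1 / 2"
    using assms(1) unfolding superlinear_convergence_def by (rule order_tendstoD) simp
  then obtain N where N: "\<And>k. N \<le> k \<Longrightarrow> norm (x (k + 1) - l) / norm (x k - l) < 1 / 2"
    by (auto simp: eventually_sequentially)
  have half: "norm (x (k + 1) - l) < 1 / 2 * norm (x k - l)" if "max N 1 \<le> k" for k
    using N[of k] assms(2)[of k] that by (simp add: pos_divide_less_eq)
  show "summable (\<lambda>k. norm (x k - l))"
  proof (rule summable_ratio_test)
    show "norm (norm (x (Suc k) - l)) \<le> 1 / 2 * norm (norm (x k - l))" if "max N 1 \<le> k" for k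
      using half[OF that] by simp
  qed simp
  show "\<forall>\<^sub>F k in sequentially. x (k + 1) \<noteq> x k"
    unfolding eventually_sequentially
  proof (intro exI[of _ "max N 1"] allI impI notI)
    fix k
    assume "max N 1 \<le> k" "x (k + 1) = x k"
    then show False using half[of k] norm_ge_zero[of "x k - l"] by simp
  qed
qed

text \<open>
  The Newton equation alone only controls \<open>V\<^sub>k (B\<^sub>k - H) s\<^sub>k\<close>, and \<open>V\<^sub>k\<close> may be singular. The claim
  comes instead from the BFGS formula: the errors \<open>|x\<^sub>k - l|\<close> have a finite sum, hence so do the
  relative secant errors, and \<open>bfgs_dennis_more\<close> applies to a tail of the sequence.
\<close>
lemma superlinear_imp_dennis_more:
  fixes f :: "real^'n \<Rightarrow> real"
  assumes f: "twice_differentiable f" "strongly_convex \<mu> f" "0 < \<mu>" "lipschitz_hessian f"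
    and hyb: "hybrid_linear_quasi_newton f g \<nu> x B"
    and ne: "\<And>k. 1 \<le> k \<Longrightarrow> x k \<noteq> l" and sup: "superlinear_convergence x l"
  shows "(\<lambda>k. norm ((B k - hessian f l) *v (x (k + 1) - x k)) / norm (x (k + 1) - x k)) \<longlonglongrightarrow> 0"
proof -
  obtain L where L: "0 < L" "\<And>a b. op_norm (hessian f a - hessian f b) \<le> L * norm (a - b)"
    using f(4) by (auto simp: lipschitz_hessian_def)
  obtain N0 where N0: "\<And>k. N0 \<le> k \<Longrightarrow> x (k + 1) \<noteq> x k"
    using superlinear_summable(2)[OF sup ne] by (auto simp: eventually_sequentially)
  \<comment> \<open>The tail starts where steps no longer vanish, and not before the first iterate.\<close>
  define N where "N = max N0 1"
  define s y \<epsilon> where "s k = x (k + 1) - x k" and "y k = grad f (x (k + 1)) - grad f (x k)"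
    and "\<epsilon> k = L * (norm (x k - l) + norm (x (k + 1) - l))" for k
  have "(\<lambda>k. norm ((B (k + N) - hessian f l) *v s (k + N)) / norm (s (k + N))) \<longlonglongrightarrow> 0"
  proof (rule bfgs_dennis_more[where y = "\<lambda>k. y (k + N)" and \<epsilon> = "\<lambda>k. \<epsilon> (k + N)"])
    show "sym_pos_def (hessian f l)" by (rule sym_pos_def_hessian[OF f(2,1,3)])
    show "sym_pos_def (B (k + N))" for k
      by (rule hybrid_matrices_sym_pos_def[OF hyb f(2,1,3)]) (simp add: N_def)
    show "B (Suc k + N) = bfgs_update (B (k + N)) (s (k + N)) (y (k + N))" for k
      using hyb by (simp add: hybrid_linear_quasi_newton_def Let_def s_def y_def N_def)
    show "s (k + N) \<noteq> 0" for k using N0[of "k + N"] by (simp add: s_def N_def)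
    show "0 \<le> \<epsilon> (k + N)" for k using L(1) by (simp add: \<epsilon>_def)
    show "norm (y (k + N) - hessian f l *v s (k + N)) \<le> \<epsilon> (k + N) * norm (s (k + N))" for k
      unfolding y_def s_def \<epsilon>_def
      by (rule grad_linearization_bound[OF f(1) less_imp_le[OF L(1)] L(2)])
    have "summable (\<lambda>k. norm (x (k + 1) - l))"
      using superlinear_summable(1)[OF sup ne] by (rule summable_ignore_initial_segment)
    then have "summable \<epsilon>"
      unfolding \<epsilon>_def using superlinear_summable(1)[OF sup ne]
      by (intro summable_mult summable_add)
    then show "summable (\<lambda>k. \<epsilon> (k + N))" by (rule summable_ignore_initial_segment)
  qed
  then show ?thesis unfolding s_def by (rule LIMSEQ_offset)
qed

text \<open>
  Let \<open>e\<^sub>k = x\<^sub>k - l\<close>, let \<open>H\<close> be the Hessian at \<open>l\<close> and \<open>A = I - V (I - \<nu> H)\<close>. Replacing \<open>B\<^sub>k\<close> by \<open>H\<close>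
  in the Newton equation and linearizing the residual yields
  \<open>A e\<^sub>k\<^sub>+\<^sub>1 = - \<nu> V \<sigma> - \<rho> - \<nu> V (B\<^sub>k - H) s\<^sub>k\<close>, where \<open>\<sigma>\<close> is the linearization error of the gradient
  and \<open>\<rho>\<close> that of the proximal map. All three terms are of smaller order than \<open>|e\<^sub>k| + |e\<^sub>k\<^sub>+\<^sub>1|\<close>, and
  \<open>A\<close> is bounded below uniformly in \<open>V\<close>.
\<close>
lemma dennis_more_imp_superlinear:
  fixes f :: "real^'n \<Rightarrow> real"
  assumes f: "twice_differentiable f" "strongly_convex \<mu> f" "0 < \<mu>" and nu: "0 < \<nu>"
    and firm: "\<And>a b. (norm (prox_scaled \<nu> g a - prox_scaled \<nu> g b))\<^sup>2
      \<le> (a - b) \<bullet> (prox_scaled \<nu> g a - prox_scaled \<nu> g b)"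
    and fixpoint: "prox_scaled \<nu> g (l - \<nu> *\<^sub>R grad f l) = l"
    and LNA: "is_LNA (B_subdifferential (prox_scaled \<nu> g)) (prox_scaled \<nu> g) (l - \<nu> *\<^sub>R grad f l)"
    and hyb: "hybrid_linear_quasi_newton f g \<nu> x B"
    and ne: "\<And>k. 1 \<le> k \<Longrightarrow> x k \<noteq> l" and conv: "x \<longlonglongrightarrow> l"
    and dm: "(\<lambda>k. norm ((B k - hessian f l) *v (x (k + 1) - x k)) / norm (x (k + 1) - x k))
      \<longlonglongrightarrow> 0"
  shows "superlinear_convergence x l"
proof -
  define P where "P = prox_scaled \<nu> g"
  define H where "H = hessian f l"
  define u where "u z = z - \<nu> *\<^sub>R grad f z" for z
  define e s where "e k = x k - l" and "s k = x (k + 1) - x k" for k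
  have B_firm: "(norm (V *v p))\<^sup>2 \<le> p \<bullet> (V *v p)" if "V \<in> B_subdifferential P z" for V z p
    using that unfolding P_def by (rule B_subdifferential_firm[OF firm])
  obtain C where C: "0 < C" "\<And>V w. (\<And>p. (norm (V *v p))\<^sup>2 \<le> p \<bullet> (V *v p))
       \<Longrightarrow> norm w \<le> C * norm ((mat 1 - V ** (mat 1 - \<nu> *\<^sub>R H)) *v w)"
    using newton_matrix_uniform_lower_bound[OF strongly_convex_hessian[OF f(2,1)] f(3) nu, of l]
    unfolding H_def by blast
  obtain K where K: "0 < K" "\<And>v. norm (H *v v) \<le> K * norm v"
    using matrix_vector_norm_bound[of H] by blast
  define Q where "Q = 1 + \<nu> * (K + 1)"
  have Q: "0 < Q" using K nu by (simp add: Q_def add_pos_pos)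
  have contraction: "\<forall>\<^sub>F k in sequentially. norm (e (k + 1)) \<le> \<delta> * norm (e k)"
    if \<delta>: "0 < \<delta>" for \<delta>
  proof -
    \<comment> \<open>From \<open>|e\<^sub>k\<^sub>+\<^sub>1| \<le> \<eta> (|e\<^sub>k| + |e\<^sub>k\<^sub>+\<^sub>1|)\<close> the contraction factor \<open>\<delta>\<close> follows because \<open>\<eta> \<le> 1/2\<close>
      allows half of \<open>|e\<^sub>k\<^sub>+\<^sub>1|\<close> to be absorbed.\<close>
    define \<eta> where "\<eta> = min (\<delta> / 2) (1 / 2)"
    define \<epsilon> where "\<epsilon> = min 1 (\<eta> / (C * (\<nu> + Q + \<nu>)))"
    have \<eta>: "0 < \<eta>" using \<delta> by (simp add: \<eta>_def)
    have den: "0 < C * (\<nu> + Q + \<nu>)" using C nu Q by (simp add: add_pos_pos)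
    have \<epsilon>: "0 < \<epsilon>" "\<epsilon> \<le> 1" using \<eta> den by (simp_all add: \<epsilon>_def)
    have \<epsilon>\<eta>: "C * (\<nu> + Q + \<nu>) * \<epsilon> \<le> \<eta>"
    proof -
      have "C * (\<nu> + Q + \<nu>) * \<epsilon> \<le> C * (\<nu> + Q + \<nu>) * (\<eta> / (C * (\<nu> + Q + \<nu>)))"
        using den by (intro mult_left_mono) (auto simp: \<epsilon>_def)
      also have "\<dots> = \<eta>"
        using den by (metis less_irrefl nonzero_mult_div_cancel_left times_divide_eq_right)
      finally show ?thesis .
    qed
    obtain d1 where d1: "0 < d1" "\<And>z. norm (z - l) < d1
        \<Longrightarrow> norm (grad f z - grad f l - H *v (z - l)) \<le> \<epsilon> * norm (z - l)"
      using twice_differentiableD(2)[OF f(1), of l, folded H_def, unfolded has_derivative_at_alt] \<epsilon>(1)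
      by blast
    have "\<forall>\<epsilon>>0. \<exists>\<delta>>0. \<forall>z. norm (u l - z) < \<delta> \<longrightarrow>
        (\<forall>A \<in> B_subdifferential P z. norm (P (u l) - P z - A *v (u l - z)) \<le> \<epsilon> * norm (u l - z))"
      using LNA unfolding is_LNA_def u_def P_def by (elim conjE)
    then obtain d2 where d2: "0 < d2" "\<And>z A. norm (u l - z) < d2 \<Longrightarrow> A \<in> B_subdifferential P z
        \<Longrightarrow> norm (P (u l) - P z - A *v (u l - z)) \<le> \<epsilon> * norm (u l - z)"
      using \<epsilon>(1) by blast
    have e0: "(\<lambda>k. norm (e k)) \<longlonglongrightarrow> 0"
      unfolding e_def using conv by (intro tendsto_norm_zero LIM_zero)
    have "\<forall>\<^sub>F k in sequentially. norm (e k) < d1"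
      using e0 d1(1) by (rule order_tendstoD)
    moreover have "\<forall>\<^sub>F k in sequentially. norm (e k) < d2 / Q"
      using e0 d2(1) Q by (intro order_tendstoD) auto
    moreover have "\<forall>\<^sub>F k in sequentially. norm ((B k - H) *v s k) / norm (s k) < \<epsilon>"
      using dm \<epsilon>(1) unfolding H_def s_def by (rule order_tendstoD)
    moreover have "\<forall>\<^sub>F k in sequentially. 1 \<le> k" by (rule eventually_ge_at_top)
    ultimately show ?thesis
    proof eventually_elim
      case (elim k)
      have spd: "sym_pos_def (B k)"
        by (rule hybrid_matrices_sym_pos_def[OF hyb f(2,1,3) elim(4)])
      have inv: "invertible (mat 1 - V ** (mat 1 - \<nu> *\<^sub>R B k))"
        if "V \<in> B_subdifferential P (u (x k))" for V
        by (rule newton_matrix_invertible[OF B_firm[OF that] spd nu])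
      obtain V where V: "V \<in> B_subdifferential P (u (x k))"
        "(mat 1 - V ** (mat 1 - \<nu> *\<^sub>R B k)) *v s k = - prox_residual f g \<nu> (x k)"
        using hybrid_step[OF hyb elim(4) inv[unfolded P_def u_def]]
        unfolding P_def u_def s_def by blast
      have V_firm: "(norm (V *v p))\<^sup>2 \<le> p \<bullet> (V *v p)" for p
        by (rule B_firm[OF V(1)])
      have V_le: "norm (V *v p) \<le> norm p" for p
      proof (rule ccontr)
        assume "\<not> norm (V *v p) \<le> norm p"
        then have "norm p * norm (V *v p) < norm (V *v p) * norm (V *v p)"
          by (intro mult_strict_right_mono) (auto intro: le_less_trans[OF norm_ge_zero])
        also have "\<dots> \<le> p \<bullet> (V *v p)" using V_firm[of p] by (simp add: power2_eq_square)
        also have "\<dots> \<le> norm p * norm (V *v p)" by (rule norm_cauchy_schwarz)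
        finally show False by simp
      qed
      define \<sigma> where "\<sigma> = grad f (x k) - grad f l - H *v e k"
      have \<sigma>: "norm \<sigma> \<le> \<epsilon> * norm (e k)"
        using d1(2)[of "x k"] elim(1) by (simp add: \<sigma>_def e_def)
      have du: "u (x k) - u l = e k - \<nu> *\<^sub>R (H *v e k) - \<nu> *\<^sub>R \<sigma>"
        by (simp add: u_def e_def \<sigma>_def algebra_simps)
      have du_le: "norm (u (x k) - u l) \<le> Q * norm (e k)"
      proof -
        have "norm (u (x k) - u l) \<le> norm (e k) + \<nu> * norm (H *v e k) + \<nu> * norm \<sigma>"
          unfolding du using nu norm_triangle_ineq4[of "e k - \<nu> *\<^sub>R (H *v e k)" "\<nu> *\<^sub>R \<sigma>"]
            norm_triangle_ineq4[of "e k" "\<nu> *\<^sub>R (H *v e k)"] by simp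
        also have "\<dots> \<le> norm (e k) + \<nu> * (K * norm (e k)) + \<nu> * (1 * norm (e k))"
        proof -
          have "norm \<sigma> \<le> 1 * norm (e k)"
            using \<sigma> mult_right_mono[OF \<epsilon>(2), of "norm (e k)"] by simp
          then show ?thesis using K(2) nu by (intro add_mono mult_left_mono) auto
        qed
        finally show ?thesis by (simp add: Q_def algebra_simps)
      qed
      define \<rho> where "\<rho> = P (u l) - P (u (x k)) - V *v (u l - u (x k))"
      have \<rho>: "norm \<rho> \<le> \<epsilon> * (Q * norm (e k))"
      proof -
        have "Q * norm (e k) < d2" using elim(2) Q by (simp add: pos_less_divide_eq mult.commute)
        then have "norm (u l - u (x k)) < d2"
          using du_le by (simp add: norm_minus_commute)
        then have "norm \<rho> \<le> \<epsilon> * norm (u l - u (x k))" unfolding \<rho>_def by (rule d2(2)[OF _ V(1)])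
        also have "\<dots> \<le> \<epsilon> * (Q * norm (e k))"
          using du_le \<epsilon>(1) by (intro mult_left_mono) (simp_all add: norm_minus_commute)
        finally show ?thesis .
      qed
      have Bs: "norm ((B k - H) *v s k) \<le> \<epsilon> * norm (s k)"
        using elim(3) by (cases "s k = 0") (simp_all add: pos_divide_less_eq)
      have sk: "s k = e (k + 1) - e k" by (simp add: s_def e_def)
      define A where "A = mat 1 - V ** (mat 1 - \<nu> *\<^sub>R H)"
      have Av: "A *v w = w - V *v w + \<nu> *\<^sub>R (V *v (H *v w))" for w
        by (simp add: A_def matrix_vector_mult_diff_rdistrib matrix_vector_mult_diff_distrib
            scaleR_matrix_vector_assoc[symmetric] matrix_vector_mult_scaleR
            flip: matrix_vector_mul_assoc)
      have Mv: "(mat 1 - V ** (mat 1 - \<nu> *\<^sub>R B k)) *v w = w - V *v w + \<nu> *\<^sub>R (V *v (B k *v w))" for w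
        by (simp add: matrix_vector_mult_diff_rdistrib matrix_vector_mult_diff_distrib
            scaleR_matrix_vector_assoc[symmetric] matrix_vector_mult_scaleR
            flip: matrix_vector_mul_assoc)
      have res: "prox_residual f g \<nu> (x k) = e k - V *v (u (x k) - u l) + \<rho>"
      proof -
        have "P (u l) = l" using fixpoint by (simp add: P_def u_def)
        then show ?thesis
          by (simp add: \<rho>_def prox_residual_def e_def matrix_vector_mult_diff_distrib P_def u_def)
      qed
      have As: "A *v s k = - prox_residual f g \<nu> (x k) - \<nu> *\<^sub>R (V *v ((B k - H) *v s k))"
        unfolding V(2)[symmetric] Mv Av
        by (simp add: matrix_vector_mult_diff_rdistrib matrix_vector_mult_diff_distrib
            scaleR_diff_right)
      have "A *v e (k + 1) = A *v e k + A *v s k"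
        by (simp add: sk flip: matrix_vector_right_distrib)
      also have "\<dots> = - (\<nu> *\<^sub>R (V *v \<sigma>)) - \<rho> - \<nu> *\<^sub>R (V *v ((B k - H) *v s k))"
        unfolding As res du Av[of "e k"]
        by (simp add: matrix_vector_mult_diff_distrib matrix_vector_mult_scaleR)
      finally have Ae: "A *v e (k + 1)
          = - (\<nu> *\<^sub>R (V *v \<sigma>)) - \<rho> - \<nu> *\<^sub>R (V *v ((B k - H) *v s k))" .
      have "norm (A *v e (k + 1)) \<le> \<nu> * norm \<sigma> + norm \<rho> + \<nu> * norm ((B k - H) *v s k)"
      proof -
        have "norm (A *v e (k + 1))
            \<le> norm (\<nu> *\<^sub>R (V *v \<sigma>)) + norm \<rho> + norm (\<nu> *\<^sub>R (V *v ((B k - H) *v s k)))"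
          unfolding Ae
          by (rule order_trans[OF norm_triangle_ineq4 add_right_mono[OF order_trans[OF norm_triangle_ineq4]]])
            simp
        also have "\<dots> \<le> \<nu> * norm \<sigma> + norm \<rho> + \<nu> * norm ((B k - H) *v s k)"
          using nu V_le by (auto intro!: add_mono mult_left_mono)
        finally show ?thesis .
      qed
      also have "\<dots> \<le> \<nu> * (\<epsilon> * norm (e k)) + \<epsilon> * (Q * norm (e k)) + \<nu> * (\<epsilon> * norm (s k))"
        using \<sigma> \<rho> Bs nu by (intro add_mono mult_left_mono) auto
      also have "\<dots> \<le> (\<nu> + Q + \<nu>) * \<epsilon> * (norm (e k) + norm (e (k + 1)))"
      proof -
        define a b where "a = norm (e k)" and "b = norm (e (k + 1))"
        have "norm (s k) \<le> a + b"
          unfolding sk a_def b_def using norm_triangle_ineq4[of "e (k + 1)" "e k"] by simp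
        then have "\<nu> * \<epsilon> * norm (s k) \<le> \<nu> * \<epsilon> * (a + b)"
          using nu \<epsilon> by (intro mult_left_mono) auto
        moreover have "0 \<le> (\<nu> + Q) * \<epsilon> * b" using nu Q \<epsilon> by (simp add: b_def)
        ultimately show ?thesis
          unfolding a_def[symmetric] b_def[symmetric] by (simp add: algebra_simps)
      qed
      finally have Ae_le: "norm (A *v e (k + 1))
          \<le> (\<nu> + Q + \<nu>) * \<epsilon> * (norm (e k) + norm (e (k + 1)))" .
      have "norm (e (k + 1)) \<le> C * norm (A *v e (k + 1))"
        unfolding A_def by (rule C(2)[OF V_firm])
      also have "\<dots> \<le> C * ((\<nu> + Q + \<nu>) * \<epsilon> * (norm (e k) + norm (e (k + 1))))"
        using Ae_le C(1) by (intro mult_left_mono) auto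
      also have "\<dots> = (C * (\<nu> + Q + \<nu>) * \<epsilon>) * (norm (e k) + norm (e (k + 1)))" by simp
      also have "\<dots> \<le> \<eta> * (norm (e k) + norm (e (k + 1)))"
        using \<epsilon>\<eta> by (intro mult_right_mono) auto
      also have "\<dots> \<le> \<delta> / 2 * norm (e k) + 1 / 2 * norm (e (k + 1))"
        unfolding distrib_left by (intro add_mono mult_right_mono) (auto simp: \<eta>_def)
      finally show ?case by simp
    qed
  qed
  show ?thesis
    unfolding superlinear_convergence_def
  proof (rule tendstoI)
    fix \<epsilon> :: real
    assume \<epsilon>: "0 < \<epsilon>"
    have "\<forall>\<^sub>F k in sequentially. norm (e (k + 1)) \<le> \<epsilon> / 2 * norm (e k)"
      using \<epsilon> by (intro contraction) simp
    moreover have "\<forall>\<^sub>F k in sequentially. 1 \<le> k" by (rule eventually_ge_at_top)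
    ultimately show "\<forall>\<^sub>F k in sequentially. dist (norm (x (k + 1) - l) / norm (x k - l)) 0 < \<epsilon>"
    proof eventually_elim
      case (elim k)
      have pos: "0 < norm (x k - l)" using ne[OF elim(2)] by simp
      then have "norm (x (k + 1) - l) / norm (x k - l) \<le> \<epsilon> / 2"
        using elim(1) unfolding e_def by (simp only: pos_divide_le_eq)
      also have "\<dots> < \<epsilon>" using \<epsilon> by simp
      finally show ?case by (simp add: dist_real_def)
    qed
  qed
qed

theorem theorem3:
  fixes f :: "real^'n \<Rightarrow> real"
    and g :: "real^'n \<Rightarrow> ereal"
    and \<mu> \<nu> :: real
    and xstar :: "real^'n"
    and x :: "nat \<Rightarrow> real^'n"
    and B :: "nat \<Rightarrow> real^'n^'n"
  assumes "twice_differentiable f"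
    and "\<mu> > 0" and "strongly_convex \<mu> f"
    and "proper g" and "closed_fun g" and "convex_fun g"
    and "\<nu> > 0"
    and "is_arg_min (\<lambda>z. ereal (f z) + g z) (\<lambda>_. True) xstar"
    and "is_LNA (B_subdifferential (prox_scaled \<nu> g)) (prox_scaled \<nu> g)
           (xstar - \<nu> *\<^sub>R grad f xstar)"
    and "lipschitz_hessian f"
    and "hybrid_linear_quasi_newton f g \<nu> x B"
    and "\<forall>k\<ge>1. x k \<noteq> xstar"
    and "x \<longlonglongrightarrow> xstar"
  shows "superlinear_convergence x xstar \<longleftrightarrow>
    (\<lambda>k. norm ((B k - hessian f xstar) *v (x (k + 1) - x k)) / norm (x (k + 1) - x k))
      \<longlonglongrightarrow> 0"
proof
  have ne: "x k \<noteq> xstar" if "1 \<le> k" for k using assms(12) that by blast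
  {
    assume sup: "superlinear_convergence x xstar"
    show "(\<lambda>k. norm ((B k - hessian f xstar) *v (x (k + 1) - x k)) / norm (x (k + 1) - x k))
      \<longlonglongrightarrow> 0"
      by (rule superlinear_imp_dennis_more[OF assms(1,3,2,10,11) ne sup])
  next
    assume dm: "(\<lambda>k. norm ((B k - hessian f xstar) *v (x (k + 1) - x k)) / norm (x (k + 1) - x k))
      \<longlonglongrightarrow> 0"
    \<comment> \<open>The optimality condition supplies the one subgradient that existence of proximal points
      requires, and it says that \<open>xstar\<close> is a zero of the residual.\<close>
    have "- grad f xstar \<in> subdifferential g xstar"
      by (rule subgradient_of_composite_minimizer[OF assms(4,6) twice_differentiableD(1)[OF assms(1)]])
        (use assms(8) in \<open>simp add: is_arg_min_linorder\<close>)
    then have "\<nu> *\<^sub>R (- grad f xstar) \<in> subdifferential (\<lambda>y. ereal \<nu> * g y) xstar"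
      by (rule subdifferential_scaled[OF _ assms(7)])
    then have sub: "(xstar - \<nu> *\<^sub>R grad f xstar) - xstar
        \<in> subdifferential (\<lambda>y. ereal \<nu> * g y) xstar" by simp
    note scaled = proper_scaled[OF assms(4,7)] closed_fun_scaled[OF assms(5,7)]
      convex_fun_scaled[OF assms(6,4,7)]
    show "superlinear_convergence x xstar"
      by (rule dennis_more_imp_superlinear[OF assms(1,3,2,7) prox_firmly_nonexpansive[OF scaled sub]
            prox_eqI[OF sub] assms(9,11) ne assms(13) dm])
  }
qed

end
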